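(* Let $G$ be a finite simple planar graph with girth at least $4$ (i.e., containing no $3$-cycles) such that no two $4$-cycles of $G$ are adjacent. Then $a^*_{eq}(G)\leq 3$; that is, for every integer $t\geq 3$, $G$ admits an equitable $t$-tree-coloring.
   Context: All graphs are finite, simple and undirected. Two cycles are adjacent if they share at least one common edge. An equitable $k$-tree-coloring of a graph $G$ is a partition of $V(G)$ into $k$ subsets such that each subset has size either $\lceil |V(G)|/k\rceil$ or $\lfloor |V(G)|/k\rfloor$ and each subset induces a forest in $G$. The strong equitable vertex arboricity $a^*_{eq}(G)$ is the smallest integer $t$ such that $G$ has an equitable $t'$-tree-coloring for every integer $t'\geq t$. *)

theory Defs
  imports "HOL-Analysis.Analysis" "HOL-Library.Extended_Nat"
begin

text \<open>A graph is given by its vertex set and its edge set, the edges being two-element sets of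
  vertices.\<close>

definition simple_graph :: "'a set \<Rightarrow> 'a set set \<Rightarrow> bool" where
  "simple_graph V E \<longleftrightarrow> finite V \<and> (\<forall>e\<in>E. e \<subseteq> V \<and> card e = 2)"

definition induced_edges :: "'a set set \<Rightarrow> 'a set \<Rightarrow> 'a set set" where
  "induced_edges E S = {e \<in> E. e \<subseteq> S}"

definition cycle_edges :: "'a list \<Rightarrow> 'a set set" where
  "cycle_edges vs = {{vs ! i, vs ! (Suc i mod length vs)} | i. i < length vs}"

text \<open>A cycle is represented by its edge set, which determines it as a subgraph. Thus the rotations
  and the reversal of a vertex sequence all denote the same cycle.\<close>

definition cycles :: "'a set set \<Rightarrow> 'a set set set" where
  "cycles E = {cycle_edges vs | vs. 3 \<le> length vs \<and> distinct vs \<and> cycle_edges vs \<subseteq> E}"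

definition cycles_of_length :: "nat \<Rightarrow> 'a set set \<Rightarrow> 'a set set set" where
  "cycles_of_length k E = {C \<in> cycles E. card C = k}"

definition adjacent_cycles :: "'a set set \<Rightarrow> 'a set set \<Rightarrow> bool" where
  "adjacent_cycles C D \<longleftrightarrow> C \<noteq> D \<and> C \<inter> D \<noteq> {}"

text \<open>The girth of a graph without cycles is \<open>\<infinity>\<close>.\<close>

definition girth :: "'a set set \<Rightarrow> enat" where
  "girth E = (INF C\<in>cycles E. enat (card C))"

definition forest :: "'a set set \<Rightarrow> bool" where
  "forest E \<longleftrightarrow> cycles E = {}"

definition plane_drawing ::
    "'a set \<Rightarrow> 'a set set \<Rightarrow> ('a \<Rightarrow> complex) \<Rightarrow> ('a set \<Rightarrow> real \<Rightarrow> complex) \<Rightarrow> bool" where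
  "plane_drawing V E p \<gamma> \<longleftrightarrow>
     inj_on p V \<and>
     (\<forall>e\<in>E. arc (\<gamma> e) \<and> {pathstart (\<gamma> e), pathfinish (\<gamma> e)} = p ` e \<and>
            path_image (\<gamma> e) \<inter> p ` V = p ` e) \<and>
     (\<forall>e\<in>E. \<forall>e'\<in>E. e \<noteq> e' \<longrightarrow> path_image (\<gamma> e) \<inter> path_image (\<gamma> e') \<subseteq> p ` (e \<inter> e'))"

definition planar :: "'a set \<Rightarrow> 'a set set \<Rightarrow> bool" where
  "planar V E \<longleftrightarrow> (\<exists>p \<gamma>. plane_drawing V E p \<gamma>)"

text \<open>The classes are indexed because some of them are empty when there are more classes than
  vertices.\<close>

definition equitable_tree_coloring ::
    "'a set \<Rightarrow> 'a set set \<Rightarrow> nat \<Rightarrow> (nat \<Rightarrow> 'a set) \<Rightarrow> bool" where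
  "equitable_tree_coloring V E k P \<longleftrightarrow>
     disjoint_family_on P {..<k} \<and> (\<Union>i<k. P i) = V \<and>
     (\<forall>i<k. (int (card (P i)) = \<lceil>real (card V) / real k\<rceil> \<or>
             int (card (P i)) = \<lfloor>real (card V) / real k\<rfloor>) \<and>
            forest (induced_edges E (P i)))"

definition has_equitable_tree_coloring :: "'a set \<Rightarrow> 'a set set \<Rightarrow> nat \<Rightarrow> bool" where
  "has_equitable_tree_coloring V E k \<longleftrightarrow> (\<exists>P. equitable_tree_coloring V E k P)"

definition strong_equitable_vertex_arboricity :: "'a set \<Rightarrow> 'a set set \<Rightarrow> nat" where
  "strong_equitable_vertex_arboricity V E =
     (LEAST t. \<forall>t'\<ge>t. has_equitable_tree_coloring V E t')"

end

theory Submission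
  imports Defs
begin

text \<open>Janiszewski's theorem and the Jordan curve theorem give Euler's inequality and show that every
  edge of a plane graph borders at most two faces. As each edge lies on at most one 4-cycle, at most
  a quarter as many faces as edges are quadrilaterals, so every subgraph on \<open>n\<close> vertices has at
  most \<open>20 n / 11\<close> edges. This density and the absence of triangles are all that is used from there on.

  Consider a smallest counterexample for \<open>t\<close> classes, and colour it without a vertex \<open>v\<close> of minimum
  degree, which is at most 3. Then exactly one class \<open>V1\<close> is too small, and every vertex outside
  \<open>V1\<close> has at least two neighbours in it, as otherwise it could move to \<open>V1\<close> and make room for \<open>v\<close>.
  If \<open>x \<in> V1\<close> has two neighbours outside \<open>V1\<close> for which it is one of only two neighbours in \<open>V1\<close>,
  these two could replace \<open>x\<close>; hence \<open>x\<close> fits into no other class, which costs edges. A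
  \<open>V1\<close>-vertex without two such neighbours costs edges because of its degree, vertices of degree 2
  and 3 having neighbours of large degree. Altogether there are more than \<open>20 n / 11\<close> edges.\<close>

section \<open>Complements of compact sets with an added arc\<close>

text \<open>The constant \<open>16/11\<close> is dictated by \<open>t = 3\<close>. There
  \<open>V1\<close> has \<open>s - 1\<close> vertices and \<open>H\<close> has
  \<open>2 s + 1\<close>, and \<open>2 (2 s + 1) + 16/11 (s - 1) = (60 s + 6)/11\<close> barely
  exceeds \<open>20/11\<close> times the \<open>3 s\<close> vertices; larger \<open>t\<close> only
  helps because \<open>20/11 < 2\<close>. This also fixes the size of the pieces: a vertex of
  \<open>V1\<close> that fits into neither of two other classes is made to receive
  \<open>8/11\<close> from each.

  The large degrees next to vertices of degree 2 and 3 come from a second reduction. The order of a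
  smallest counterexample turns out to be a multiple of \<open>t\<close>, so an equitable colouring
  of all but three vertices has exactly three classes that are one short. The three vertices go back
  into three different ones if they have at most 1, 3 and 5 neighbours among the coloured vertices.

  On the topological side a face is a component of the complement of the drawing, and its boundary
  is a set of edges rather than a closed walk. Graphs may be disconnected, so Euler's formula
  becomes an inequality that also counts connected components.\<close>

text \<open>Invariance of dimension forbids an open plane set inside a copy of an interval. Hence an
  added arc never swallows a whole face.\<close>

lemma open_subset_arc_empty:
  fixes g :: "real \<Rightarrow> complex"
  assumes "arc g" "open U" "U \<subseteq> path_image g"
  shows "U = {}"
proof (rule ccontr)
  assume ne: "U \<noteq> {}"
  have "path_image g homeomorphic {0..1::real}"
    using assms(1) by (simp add: homeomorphic_arc_image_interval)
  then obtain f f' where "homeomorphism (path_image g) {0..1::real} f f'"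
    by (auto simp: homeomorphic_def)
  then have "continuous_on (path_image g) f" "inj_on f (path_image g)"
    by (auto simp: homeomorphism_def intro: inj_on_inverseI)
  then have "continuous_on U f" "inj_on f U"
    using assms(3) continuous_on_subset inj_on_subset by blast+
  then have "DIM(complex) \<le> DIM(real)"
    using invariance_of_dimension[of U f] assms(2) ne by blast
  then show False by simp
qed

lemma component_of_point:
  assumes "K \<in> components S" "z \<in> K"
  shows "K = connected_component_set S z"
  using assms by (metis components_iff connected_component_eq)

text \<open>The map \<open>\<sigma>\<close> tells the two sides of an added arc apart.\<close>

lemma finite_components_refine:
  fixes X Y :: "complex set" and \<sigma> :: "complex \<Rightarrow> bool"
  assumes "X \<subseteq> Y" and fin: "finite (components (- X))"
    and split: "\<And>z w. z \<notin> Y \<Longrightarrow> w \<notin> Y \<Longrightarrow> connected_component (- X) z w \<Longrightarrow> \<sigma> z = \<sigma> w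
                \<Longrightarrow> connected_component (- Y) z w"
  shows "finite (components (- Y))"
proof -
  define r where "r = (\<lambda>K. SOME z :: complex. z \<in> K)"
  have r: "r K \<in> K" if "K \<in> components (- Y)" for K
    unfolding r_def using in_components_nonempty[OF that] by (simp add: some_in_eq)
  have rY: "r K \<notin> Y" if "K \<in> components (- Y)" for K
    using r[OF that] in_components_subset[OF that] by auto
  \<comment> \<open>A component of \<open>- Y\<close> is encoded by the surrounding component of
    \<open>- X\<close> and a side; \<open>split\<close> makes this code injective.\<close>
  define F where "F = (\<lambda>K. (connected_component_set (- X) (r K), \<sigma> (r K)))"
  have "inj_on F (components (- Y))"
  proof (rule inj_onI)
    fix K L assume K: "K \<in> components (- Y)" and L: "L \<in> components (- Y)" and eq: "F K = F L"
    have "r L \<in> connected_component_set (- X) (r L)"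
      using rY[OF L] assms(1) by auto
    then have "connected_component (- X) (r K) (r L)" using eq by (auto simp: F_def)
    then have "connected_component (- Y) (r K) (r L)"
      using split rY K L eq by (auto simp: F_def)
    then have "connected_component_set (- Y) (r K) = connected_component_set (- Y) (r L)"
      by (simp add: connected_component_eq)
    then show "K = L" using component_of_point r K L by metis
  qed
  moreover have "F ` components (- Y) \<subseteq> components (- X) \<times> UNIV"
    using rY assms(1) by (auto simp: F_def components_def)
  ultimately show ?thesis
    using fin by (meson finite_SigmaI finite inj_on_finite)
qed

text \<open>The map \<pi> sends each component of \<open>- Y\<close> to the component of
  \<open>- X\<close> around it. It is onto because a component of \<open>- X\<close> is open and so
  cannot lie inside \<open>Y\<close>.\<close>

lemma components_image_refine:
  fixes X Y :: "complex set"
  assumes "X \<subseteq> Y" "closed X" "\<And>U. open U \<Longrightarrow> U \<subseteq> - X \<Longrightarrow> U \<subseteq> Y \<Longrightarrow> U = {}"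
  obtains \<pi> where "components (- X) = \<pi> ` components (- Y)"
    "\<And>z. z \<notin> Y \<Longrightarrow> \<pi> (connected_component_set (- Y) z) = connected_component_set (- X) z"
proof -
  define \<pi> where "\<pi> = (\<lambda>K. connected_component_set (- X) (SOME z. z \<in> K))"
  have \<pi>: "\<pi> (connected_component_set (- Y) z) = connected_component_set (- X) z" if "z \<notin> Y" for z
  proof -
    let ?K = "connected_component_set (- Y) z"
    have "z \<in> ?K" using that by auto
    then have "(SOME z. z \<in> ?K) \<in> ?K" by (rule someI)
    then have "connected_component (- Y) z (SOME z. z \<in> ?K)" by simp
    then have "connected_component (- X) z (SOME z. z \<in> ?K)"
      using assms(1) by (meson Compl_subset_Compl_iff connected_component_of_subset)
    then show ?thesis unfolding \<pi>_def by (metis connected_component_eq mem_Collect_eq)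
  qed
  have "components (- X) = \<pi> ` components (- Y)"
  proof (intro equalityI subsetI)
    fix F assume F: "F \<in> components (- X)"
    have "open F" using open_components[OF open_Compl[OF assms(2)] F] .
    moreover have "F \<noteq> {}" "F \<subseteq> - X" using F in_components_nonempty in_components_subset by blast+
    ultimately obtain z where z: "z \<in> F" "z \<notin> Y" using assms(3) by blast
    have "F = connected_component_set (- X) z" using component_of_point F z by blast
    then have "F = \<pi> (connected_component_set (- Y) z)" using \<pi> z by simp
    moreover have "connected_component_set (- Y) z \<in> components (- Y)" using z by (auto simp: components_def)
    ultimately show "F \<in> \<pi> ` components (- Y)" by blast
  next
    fix F assume "F \<in> \<pi> ` components (- Y)"
    then obtain z where "z \<in> - Y" "F = connected_component_set (- X) z"
      using \<pi> by (auto simp: components_def)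
    then show "F \<in> components (- X)" using assms(1) by (auto simp: components_def)
  qed
  with \<pi> that show ?thesis by blast
qed

text \<open>Two points that are joined off \<open>X\<close> but separated off \<open>Y\<close> show
  that \<pi> is not injective, which makes the inequality strict.\<close>

lemma card_components_refine:
  fixes X Y :: "complex set"
  assumes "X \<subseteq> Y" "closed X" "\<And>U. open U \<Longrightarrow> U \<subseteq> - X \<Longrightarrow> U \<subseteq> Y \<Longrightarrow> U = {}"
    and fin: "finite (components (- Y))"
  shows "card (components (- X)) \<le> card (components (- Y))"
    and "connected_component (- X) z w \<Longrightarrow> z \<notin> Y \<Longrightarrow> w \<notin> Y \<Longrightarrow> \<not> connected_component (- Y) z w
         \<Longrightarrow> card (components (- X)) < card (components (- Y))"
proof -
  obtain \<pi> where \<pi>: "components (- X) = \<pi> ` components (- Y)"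
    "\<And>z. z \<notin> Y \<Longrightarrow> \<pi> (connected_component_set (- Y) z) = connected_component_set (- X) z"
    using components_image_refine[OF assms(1,2,3)] by blast
  show le: "card (components (- X)) \<le> card (components (- Y))"
    unfolding \<pi>(1) using fin by (rule card_image_le)
  assume zw: "connected_component (- X) z w" "z \<notin> Y" "w \<notin> Y" "\<not> connected_component (- Y) z w"
  have "\<not> inj_on \<pi> (components (- Y))"
  proof
    assume inj: "inj_on \<pi> (components (- Y))"
    have "\<pi> (connected_component_set (- Y) z) = \<pi> (connected_component_set (- Y) w)"
      using \<pi>(2) zw by (simp add: connected_component_eq)
    then have "connected_component_set (- Y) z = connected_component_set (- Y) w"
      using inj zw by (auto simp: components_def dest: inj_onD)
    moreover have "w \<in> connected_component_set (- Y) w" using zw by auto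
    ultimately show False using zw by auto
  qed
  then have "card (\<pi> ` components (- Y)) \<noteq> card (components (- Y))"
    using fin by (metis eq_card_imp_inj_on)
  then show "card (components (- X)) < card (components (- Y))" using le \<pi>(1) by simp
qed

text \<open>A component touching \<open>A\<close> contains points near \<open>A\<close>, and these
  lie in the one component of \<open>- X\<close> that contains \<open>A\<close>. Only the value of
  \<sigma> is left to tell such components apart. With \<open>A\<close> an open edge this bounds the
  faces at the edge.\<close>

lemma card_components_touching:
  fixes X Y A :: "complex set" and \<sigma> :: "complex \<Rightarrow> bool"
  assumes "closed X" "X \<subseteq> Y" "connected A" "A \<inter> X = {}"
    and split: "\<And>z w. z \<notin> Y \<Longrightarrow> w \<notin> Y \<Longrightarrow> connected_component (- X) z w \<Longrightarrow> \<sigma> z = \<sigma> w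
                \<Longrightarrow> connected_component (- Y) z w"
  shows "finite {K \<in> components (- Y). frontier K \<inter> A \<noteq> {}} \<and>
         card {K \<in> components (- Y). frontier K \<inter> A \<noteq> {}} \<le> 2"
proof -
  let ?T = "{K \<in> components (- Y). frontier K \<inter> A \<noteq> {}}"
  have "\<exists>z q. z \<in> K \<and> z \<notin> Y \<and> q \<in> A \<and> connected_component (- X) q z" if KT: "K \<in> ?T" for K
  proof -
    obtain q where q: "q \<in> frontier K" "q \<in> A" using KT by auto
    have "q \<in> - X" using q assms(4) by auto
    then obtain r where r: "r > 0" "ball q r \<subseteq> - X"
      using assms(1) by (meson open_Compl open_contains_ball)
    have "q \<in> closure K" using q by (simp add: frontier_def)
    then obtain z where z: "z \<in> K" "dist z q < r" using r(1) by (auto simp: closure_approachable)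
    have "z \<in> ball q r" "q \<in> ball q r" using z r by (auto simp: dist_commute)
    then have "connected_component (- X) q z"
      unfolding connected_component_def using r(2) connected_ball by blast
    moreover have "z \<notin> Y" using z KT in_components_subset by blast
    ultimately show ?thesis using z q by blast
  qed
  then obtain r where r: "\<And>K. K \<in> ?T \<Longrightarrow> r K \<in> K \<and> r K \<notin> Y \<and> (\<exists>q\<in>A. connected_component (- X) q (r K))"
    by metis
  have "inj_on (\<lambda>K. \<sigma> (r K)) ?T"
  proof (rule inj_onI)
    fix K L assume K: "K \<in> ?T" and L: "L \<in> ?T" and eq: "\<sigma> (r K) = \<sigma> (r L)"
    obtain q q' where q: "q \<in> A" "q' \<in> A" "connected_component (- X) q (r K)" "connected_component (- X) q' (r L)"
      using r K L by meson
    have "connected_component (- X) q q'"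
      unfolding connected_component_def using q assms(3,4) by blast
    then have "connected_component (- X) (r K) (r L)"
      using q by (meson connected_component_sym connected_component_trans)
    then have "connected_component (- Y) (r K) (r L)" using split r K L eq by blast
    then have "connected_component_set (- Y) (r K) = connected_component_set (- Y) (r L)"
      by (simp add: connected_component_eq)
    moreover have "K = connected_component_set (- Y) (r K)" "L = connected_component_set (- Y) (r L)"
      using component_of_point[of K "- Y" "r K"] component_of_point[of L "- Y" "r L"] r K L by blast+
    ultimately show "K = L" by simp
  qed
  then show ?thesis
    using card_inj_on_le[of _ ?T "UNIV :: bool set"] inj_on_finite[of _ ?T "UNIV :: bool set"] by auto
qed

text \<open>Janiszewski's theorem is applied twice, each time with a one-point intersection.\<close>

lemma connected_component_add_arc_bridge:
  fixes Q :: "real \<Rightarrow> complex"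
  assumes "compact X1" "compact X2" "X1 \<inter> X2 = {}" "arc Q"
    and "X1 \<inter> path_image Q = {a}" "X2 \<inter> path_image Q = {b}"
    and "z \<notin> path_image Q" "w \<notin> path_image Q"
    and cc: "connected_component (- (X1 \<union> X2)) z w"
  shows "connected_component (- (X1 \<union> X2 \<union> path_image Q)) z w"
proof -
  have "connected (- path_image Q)" using assms(4) by (intro connected_arc_complement) auto
  then have ccQ: "connected_component (- path_image Q) z w"
    unfolding connected_component_def using assms(7,8) by blast
  have "connected_component (- X1) z w" "connected_component (- X2) z w"
    using cc by (auto elim!: connected_component_of_subset)
  then have "connected_component (- (X1 \<union> path_image Q)) z w"
    using ccQ assms by (intro Janiszewski[OF assms(1)]) (auto simp: closed_arc_image)
  moreover have "(X1 \<union> path_image Q) \<inter> X2 = {b}" using assms by blast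
  ultimately have "connected_component (- ((X1 \<union> path_image Q) \<union> X2)) z w"
    using \<open>connected_component (- X2) z w\<close> compact_imp_closed[OF assms(2)]
    by (intro Janiszewski[OF compact_Un[OF assms(1) compact_arc_image[OF assms(4)]]]) auto
  then show ?thesis by (simp add: Un_ac)
qed

text \<open>Janiszewski's theorem for \<open>X\<close> and the closed curve made of \<open>P\<close>
  and \<open>Q\<close>: their intersection is exactly the connected set
  \<open>path_image P\<close>.\<close>

lemma connected_component_add_arc_cycle:
  fixes P Q :: "real \<Rightarrow> complex"
  assumes "compact X" "arc P" "arc Q" "path_image P \<subseteq> X"
    and "X \<inter> path_image Q \<subseteq> path_image P"
    and "connected_component (- X) z w"
    and "connected_component (- (path_image P \<union> path_image Q)) z w"
  shows "connected_component (- (X \<union> path_image Q)) z w"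
proof -
  have "X \<inter> (path_image P \<union> path_image Q) = path_image P" using assms by blast
  then have "connected_component (- (X \<union> (path_image P \<union> path_image Q))) z w"
    by (intro Janiszewski[OF assms(1) _ _ assms(6,7)])
      (use assms in \<open>auto simp: closed_arc_image connected_arc_image closed_Un\<close>)
  moreover have "X \<union> (path_image P \<union> path_image Q) = X \<union> path_image Q" using assms by blast
  ultimately show ?thesis by simp
qed

lemma arc_pair_Jordan:
  fixes P Q :: "real \<Rightarrow> complex"
  assumes "arc P" "arc Q" "pathstart P = pathstart Q" "pathfinish P = pathfinish Q"
    and "path_image P \<inter> path_image Q \<subseteq> {pathstart Q, pathfinish Q}"
  obtains I M where "open I" "connected I" "connected M" "I \<inter> M = {}"
    "I \<union> M = - (path_image P \<union> path_image Q)"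
    "frontier I = path_image P \<union> path_image Q" "frontier M = path_image P \<union> path_image Q"
proof -
  let ?c = "P +++ reversepath Q"
  have im: "path_image ?c = path_image P \<union> path_image Q"
    using assms by (simp add: path_image_join)
  have "simple_path ?c"
    using assms by (intro simple_path_join_loop) (auto simp: arc_reversepath)
  moreover have "pathfinish ?c = pathstart ?c" using assms by simp
  ultimately show ?thesis
    using Jordan_inside_outside[of ?c] that[of "inside (path_image ?c)" "outside (path_image ?c)"]
    unfolding im by auto
qed

text \<open>Here \<sigma> is membership in the inside of the Jordan curve formed by \<open>P\<close>
  and \<open>Q\<close>. An inner point of \<open>Q\<close> has a ball missing \<open>X\<close>, and
  this ball meets both sides because each has the whole curve as its frontier; so \<open>Q\<close>
  really cuts a component.\<close>

lemma add_arc_cycle_splits: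
  fixes P Q :: "real \<Rightarrow> complex"
  assumes "compact X" "arc P" "arc Q" "path_image P \<subseteq> X"
    and st: "pathstart P = pathstart Q" "pathfinish P = pathfinish Q"
    and XQ: "X \<inter> path_image Q = {pathstart Q, pathfinish Q}"
  obtains \<sigma> :: "complex \<Rightarrow> bool" and z w where
    "\<And>z w. z \<notin> X \<union> path_image Q \<Longrightarrow> w \<notin> X \<union> path_image Q \<Longrightarrow> connected_component (- X) z w \<Longrightarrow>
      \<sigma> z = \<sigma> w \<Longrightarrow> connected_component (- (X \<union> path_image Q)) z w"
    "connected_component (- X) z w" "z \<notin> X \<union> path_image Q" "w \<notin> X \<union> path_image Q"
    "\<not> connected_component (- (X \<union> path_image Q)) z w"
proof -
  let ?J = "path_image P \<union> path_image Q"
  have PQ: "path_image P \<inter> path_image Q \<subseteq> {pathstart Q, pathfinish Q}" using assms by blast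
  obtain I M where J: "open I" "connected I" "connected M" "I \<inter> M = {}" "I \<union> M = - ?J"
    "frontier I = ?J" "frontier M = ?J"
    using arc_pair_Jordan[OF assms(2,3) st PQ] by blast
  have sub: "X \<inter> path_image Q \<subseteq> path_image P"
    using XQ st pathstart_in_path_image[of P] pathfinish_in_path_image[of P] by auto
  have 1: "connected_component (- (X \<union> path_image Q)) z w"
    if "z \<notin> X \<union> path_image Q" "w \<notin> X \<union> path_image Q" "connected_component (- X) z w" "(z \<in> I) = (w \<in> I)"
    for z w
  proof -
    have "z \<in> I \<union> M" "w \<in> I \<union> M" using that assms(4) J(5) by auto
    then have "(z \<in> I \<and> w \<in> I) \<or> (z \<in> M \<and> w \<in> M)" using that(4) by blast
    then have "connected_component (- ?J) z w"
      unfolding connected_component_def using J(2,3,5) by (metis Un_upper1 Un_upper2)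
    then show ?thesis
      using connected_component_add_arc_cycle[OF assms(1,2,3,4) sub that(3)] by blast
  qed
  have "path_image Q - {pathstart Q, pathfinish Q} \<noteq> {}"
    using assms(3) by (intro nonempty_simple_path_endless) (auto simp: arc_imp_simple_path)
  then obtain q where q: "q \<in> path_image Q" "q \<notin> X" using XQ by blast
  then obtain r where r: "r > 0" "ball q r \<subseteq> - X"
    using assms(1) by (metis ComplI compact_imp_closed open_Compl open_contains_ball)
  have "q \<in> closure I" "q \<in> closure M" using q J(6,7) by (auto simp: frontier_def)
  then obtain z w where zw: "z \<in> I" "dist z q < r" "w \<in> M" "dist w q < r"
    using r(1) by (meson closure_approachable)
  have "z \<in> ball q r" "w \<in> ball q r" using zw by (auto simp: dist_commute)
  then have 2: "connected_component (- X) z w" "z \<notin> X" "w \<notin> X"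
    unfolding connected_component_def using r(2) connected_ball by blast+
  have 3: "z \<notin> path_image Q" "w \<notin> path_image Q" using zw J(5) by auto
  have 4: "\<not> connected_component (- (X \<union> path_image Q)) z w"
  proof
    assume "connected_component (- (X \<union> path_image Q)) z w"
    then obtain T where T: "connected T" "T \<subseteq> - (X \<union> path_image Q)" "z \<in> T" "w \<in> T"
      by (auto simp: connected_component_def)
    have "T \<inter> I \<noteq> {}" "T - I \<noteq> {}" using T zw J(4) by auto
    then have "T \<inter> frontier I \<noteq> {}" using T(1) connected_Int_frontier by blast
    then show False using J(6) T(2) assms(4) by auto
  qed
  show ?thesis using that[of "\<lambda>z. z \<in> I" z w] 1 2 3 4 by blast
qed

section \<open>Faces of plane graphs\<close>

definition edge_rel :: "'a set set \<Rightarrow> ('a \<times> 'a) set" where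
  "edge_rel F = {(u, w). {u, w} \<in> F}"

lemma sym_edge_rel: "sym (edge_rel F)"
  by (auto simp: edge_rel_def sym_def insert_commute)

text \<open>The walk is kept simple while it grows: if the next vertex already occurs, the list is
  cut back to that occurrence.\<close>

lemma edge_rel_path:
  assumes "(u, w) \<in> (edge_rel F)\<^sup>*"
  obtains vs where "distinct vs" "vs \<noteq> []" "hd vs = u" "last vs = w"
    "\<And>i. Suc i < length vs \<Longrightarrow> {vs ! i, vs ! Suc i} \<in> F"
proof -
  have "\<exists>vs. distinct vs \<and> vs \<noteq> [] \<and> hd vs = u \<and> last vs = w \<and>
      (\<forall>i. Suc i < length vs \<longrightarrow> {vs ! i, vs ! Suc i} \<in> F)"
    using assms
  proof (induction rule: rtrancl_induct)
    case base
    show ?case by (intro exI[of _ "[u]"]) auto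
  next
    case (step y z)
    then obtain vs where vs: "distinct vs" "vs \<noteq> []" "hd vs = u" "last vs = y"
      "\<And>i. Suc i < length vs \<Longrightarrow> {vs ! i, vs ! Suc i} \<in> F" by blast
    have yz: "{y, z} \<in> F" using step by (auto simp: edge_rel_def)
    show ?case
    proof (cases "z \<in> set vs")
      case True
      then obtain k where k: "k < length vs" "vs ! k = z" by (auto simp: in_set_conv_nth)
      have ne: "take (Suc k) vs \<noteq> []" using vs(2) by simp
      have "last (take (Suc k) vs) = z" using k by (simp add: take_Suc_conv_app_nth)
      moreover have "hd (take (Suc k) vs) = u" using vs by (simp add: hd_take)
      ultimately show ?thesis using vs ne k
        by (intro exI[of _ "take (Suc k) vs"]) auto
    next
      case False
      have "{(vs @ [z]) ! i, (vs @ [z]) ! Suc i} \<in> F" if "Suc i < length (vs @ [z])" for i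
      proof (cases "Suc i < length vs")
        case True
        then show ?thesis using vs(5) by (simp add: nth_append)
      next
        case F: False
        then have "Suc i = length vs" using that by simp
        then have "i = length vs - 1" "i < length vs" by linarith+
        then have "(vs @ [z]) ! i = y" using vs(2,4) by (simp add: nth_append last_conv_nth)
        moreover have "(vs @ [z]) ! Suc i = z" using \<open>Suc i = length vs\<close> by (simp add: nth_append)
        ultimately show ?thesis using yz by simp
      qed
      then show ?thesis using vs False by (intro exI[of _ "vs @ [z]"]) auto
    qed
  qed
  then show ?thesis using that by blast
qed

text \<open>The new edge closes a path from \<open>u\<close> to \<open>w\<close>. As
  \<open>{u, w}\<close> is not yet present, the path has an inner vertex, so the cycle has length at
  least 3. Used contrapositively: an edge added within a forest is a bridge.\<close>

lemma ex_cycle_if_connected: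
  assumes "(u, w) \<in> (edge_rel F)\<^sup>*" "u \<noteq> w" "{u, w} \<notin> F"
  shows "cycles (insert {u, w} F) \<noteq> {}"
proof -
  obtain vs where vs: "distinct vs" "vs \<noteq> []" "hd vs = u" "last vs = w"
    "\<And>i. Suc i < length vs \<Longrightarrow> {vs ! i, vs ! Suc i} \<in> F"
    using edge_rel_path[OF assms(1)] by blast
  have ends: "vs ! 0 = u" "vs ! (length vs - 1) = w" using vs by (auto simp: hd_conv_nth last_conv_nth)
  have "length vs \<noteq> 1" using ends assms(2) by auto
  moreover have "length vs \<noteq> 2" using ends vs(5)[of 0] assms(3) by (auto simp: numeral_2_eq_2)
  moreover have "length vs \<noteq> 0" using vs(2) by simp
  ultimately have "3 \<le> length vs" by linarith
  moreover have "cycle_edges vs \<subseteq> insert {u, w} F"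
  proof
    fix e assume "e \<in> cycle_edges vs"
    then obtain i where i: "i < length vs" "e = {vs ! i, vs ! (Suc i mod length vs)}"
      by (auto simp: cycle_edges_def)
    show "e \<in> insert {u, w} F"
    proof (cases "Suc i < length vs")
      case True
      then show ?thesis using i vs(5) by simp
    next
      case False
      then have "Suc i = length vs" using i by simp
      then have "i = length vs - 1" "Suc i mod length vs = 0" by auto
      then have "e = {w, u}" using i(2) ends by simp
      then show ?thesis by (simp add: insert_commute)
    qed
  qed
  ultimately show ?thesis using vs(1) by (auto simp: cycles_def)
qed

lemma cycles_mono: "F \<subseteq> F' \<Longrightarrow> cycles F \<subseteq> cycles F'"
  by (auto simp: cycles_def)

section \<open>Drawings of subgraphs and the effect of one more edge\<close>

locale plane_graph =
  fixes V :: "'a set" and E :: "'a set set" and p :: "'a \<Rightarrow> complex" and \<gamma> :: "'a set \<Rightarrow> real \<Rightarrow> complex"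
  assumes simple: "simple_graph V E" and drawing: "plane_drawing V E p \<gamma>"
begin

text \<open>All vertices are drawn whatever \<open>F\<close> is, so a new edge adds one arc that
  meets the rest exactly in its two ends.\<close>

definition D :: "'a set set \<Rightarrow> complex set" where
  "D F = p ` V \<union> (\<Union>e\<in>F. path_image (\<gamma> e))"

lemma finite_V: "finite V" and finite_E: "finite E" and E_sub: "e \<in> E \<Longrightarrow> e \<subseteq> V" and E_card: "e \<in> E \<Longrightarrow> card e = 2"
proof -
  show V: "finite V" and "e \<in> E \<Longrightarrow> e \<subseteq> V" and "e \<in> E \<Longrightarrow> card e = 2"
    using simple by (auto simp: simple_graph_def)
  have "E \<subseteq> Pow V" using simple by (auto simp: simple_graph_def)
  then show "finite E" using V by (meson finite_Pow_iff finite_subset)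
qed

lemma inj_p: "inj_on p V" using drawing by (simp add: plane_drawing_def)
lemma arc_edge: "e \<in> E \<Longrightarrow> arc (\<gamma> e)" using drawing by (simp add: plane_drawing_def)
lemma ends_edge: "e \<in> E \<Longrightarrow> {pathstart (\<gamma> e), pathfinish (\<gamma> e)} = p ` e"
  using drawing by (simp add: plane_drawing_def)
lemma edge_Int_V: "e \<in> E \<Longrightarrow> path_image (\<gamma> e) \<inter> p ` V = p ` e"
  using drawing by (simp add: plane_drawing_def)
lemma edge_Int_edge: "e \<in> E \<Longrightarrow> e' \<in> E \<Longrightarrow> e \<noteq> e' \<Longrightarrow> path_image (\<gamma> e) \<inter> path_image (\<gamma> e') \<subseteq> p ` (e \<inter> e')"
  using drawing by (simp add: plane_drawing_def)

lemma edge_ends: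
  assumes "e \<in> E"
  obtains u w where "e = {u, w}" "u \<noteq> w" "u \<in> V" "w \<in> V" "pathstart (\<gamma> e) = p u" "pathfinish (\<gamma> e) = p w"
proof -
  obtain u w where uw: "e = {u, w}" "u \<noteq> w" using E_card[OF assms] by (auto simp: card_2_iff)
  have V: "u \<in> V" "w \<in> V" using E_sub[OF assms] uw by auto
  have "{pathstart (\<gamma> e), pathfinish (\<gamma> e)} = {p u, p w}" using ends_edge[OF assms] uw by simp
  then have "(pathstart (\<gamma> e) = p u \<and> pathfinish (\<gamma> e) = p w) \<or> (pathstart (\<gamma> e) = p w \<and> pathfinish (\<gamma> e) = p u)"
    by (auto simp: doubleton_eq_iff)
  then show ?thesis
    using that[of u w] that[of w u] uw V by (auto simp: insert_commute)
qed

lemma compact_drawn: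
  assumes "A \<subseteq> V" "F \<subseteq> E"
  shows "compact (p ` A \<union> (\<Union>e\<in>F. path_image (\<gamma> e)))"
proof (rule compact_Un)
  show "compact (p ` A)" using assms(1) finite_V by (meson finite_imageI finite_imp_compact finite_subset)
  have "finite F" using assms(2) finite_E finite_subset by blast
  then show "compact (\<Union>e\<in>F. path_image (\<gamma> e))"
    using assms(2) arc_edge by (intro compact_UN) (auto simp: compact_arc_image)
qed

lemma compact_D: "F \<subseteq> E \<Longrightarrow> compact (D F)"
  unfolding D_def by (rule compact_drawn) auto

lemma closed_D: "F \<subseteq> E \<Longrightarrow> closed (D F)"
  using compact_D compact_imp_closed by blast

lemma D_mono: "F \<subseteq> F' \<Longrightarrow> D F \<subseteq> D F'"
  by (auto simp: D_def)

lemma D_insert: "D (insert e F) = D F \<union> path_image (\<gamma> e)"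
  by (auto simp: D_def)

lemma D_Int_edge:
  assumes "F \<subseteq> E" "e \<in> E" "e \<notin> F"
  shows "D F \<inter> path_image (\<gamma> e) = p ` e"
proof
  show "p ` e \<subseteq> D F \<inter> path_image (\<gamma> e)" using edge_Int_V[OF assms(2)] by (auto simp: D_def)
  show "D F \<inter> path_image (\<gamma> e) \<subseteq> p ` e"
  proof
    fix z assume z: "z \<in> D F \<inter> path_image (\<gamma> e)"
    show "z \<in> p ` e"
    proof (cases "z \<in> p ` V")
      case True
      then show ?thesis using z edge_Int_V[OF assms(2)] by blast
    next
      case False
      then obtain e' where "e' \<in> F" "z \<in> path_image (\<gamma> e')" using z by (auto simp: D_def)
      then show ?thesis using edge_Int_edge[OF assms(2), of e'] assms z by blast
    qed
  qed
qed

lemma path_component_D: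
  assumes "F \<subseteq> E" "u \<in> V" "(u, w) \<in> (edge_rel F)\<^sup>*"
  shows "path_component (D F) (p u) (p w)"
  using assms(3)
proof (induction rule: rtrancl_induct)
  case base
  show ?case using assms(2) by (auto simp: D_def intro: path_component_refl)
next
  case (step y z)
  have e: "{y, z} \<in> F" "{y, z} \<in> E" using step assms(1) by (auto simp: edge_rel_def)
  have "p y \<in> path_image (\<gamma> {y, z})" "p z \<in> path_image (\<gamma> {y, z})"
    using edge_Int_V[OF e(2)] by auto
  then have "path_component (path_image (\<gamma> {y, z})) (p y) (p z)"
    using path_connected_path_image[OF arc_imp_path[OF arc_edge[OF e(2)]]]
    by (simp add: path_connected_component)
  then have "path_component (D F) (p y) (p z)"
    using e(1) by (elim path_component_of_subset[rotated]) (auto simp: D_def)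
  then show ?case using step.IH path_component_trans by blast
qed

text \<open>The drawing falls into the part \<open>X1\<close> belonging to the connected component
  \<open>C\<close> of \<open>u\<close> and the part \<open>X2\<close> of everything else. These are
  disjoint compact sets, and the new arc meets each in one of its ends.\<close>

lemma insert_bridge:
  assumes F: "F \<subseteq> E" and e: "e \<in> E" "e \<notin> F" "e = {u, w}" and nc: "(u, w) \<notin> (edge_rel F)\<^sup>*"
    and z: "z \<notin> D (insert e F)" "z' \<notin> D (insert e F)" "connected_component (- D F) z z'"
  shows "connected_component (- D (insert e F)) z z'"
proof -
  define C where "C = (edge_rel F)\<^sup>* `` {u}"
  define X1 where "X1 = p ` (V \<inter> C) \<union> (\<Union>e\<in>{e \<in> F. e \<inter> C \<noteq> {}}. path_image (\<gamma> e))"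
  define X2 where "X2 = p ` (V - C) \<union> (\<Union>e\<in>{e \<in> F. e \<inter> C = {}}. path_image (\<gamma> e))"
  have V: "u \<in> V" "w \<in> V" using E_sub[OF e(1)] e(3) by auto
  have C: "u \<in> C" "w \<notin> C" using nc by (auto simp: C_def)
  have step: "g \<subseteq> C" if g: "g \<in> F" "g \<inter> C \<noteq> {}" for g
  proof -
    obtain y y' where y: "g = {y, y'}" using E_card[of g] g F by (auto simp: card_2_iff)
    have "(y, y') \<in> edge_rel F" "(y', y) \<in> edge_rel F" using y g by (auto simp: edge_rel_def insert_commute)
    then show ?thesis using g y by (auto simp: C_def intro: rtrancl_into_rtrancl)
  qed
  have cpt: "compact X1" "compact X2"
    unfolding X1_def X2_def by (rule compact_drawn; use F in auto)+
  \<comment> \<open>Every edge of \<open>F\<close> lies inside \<open>C\<close> or avoids it, and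
    drawn edges meet only in common vertices.\<close>
  have disj: "X1 \<inter> X2 = {}"
  proof (rule ccontr)
    assume "X1 \<inter> X2 \<noteq> {}"
    then obtain q where q: "q \<in> X1" "q \<in> X2" by blast
    have pin: "p x = p y \<Longrightarrow> x = y" if "x \<in> V" "y \<in> V" for x y using inj_p that by (auto dest: inj_onD)
    have VC: "x \<in> C" if x: "x \<in> V" "p x \<in> X1" for x
    proof -
      consider y where "y \<in> V" "y \<in> C" "p x = p y" | g where "g \<in> F" "g \<inter> C \<noteq> {}" "p x \<in> path_image (\<gamma> g)"
        using x by (auto simp: X1_def)
      then show ?thesis
      proof cases
        case 1 then show ?thesis using pin x by blast
      next
        case 2
        have g: "g \<in> E" using 2 F by auto
        then have "p x \<in> p ` g" using edge_Int_V 2 x by blast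
        then have "x \<in> g" using pin x E_sub[OF g] by blast
        then show ?thesis using step 2 by blast
      qed
    qed
    have VC2: "x \<notin> C" if x: "x \<in> V" "p x \<in> X2" for x
    proof -
      consider y where "y \<in> V" "y \<notin> C" "p x = p y" | g where "g \<in> F" "g \<inter> C = {}" "p x \<in> path_image (\<gamma> g)"
        using x by (auto simp: X2_def)
      then show ?thesis
      proof cases
        case 1 then show ?thesis using pin x by blast
      next
        case 2
        have g: "g \<in> E" using 2 F by auto
        then have "p x \<in> p ` g" using edge_Int_V 2 x by blast
        then have "x \<in> g" using pin x E_sub[OF g] by blast
        then show ?thesis using 2 by blast
      qed
    qed
    show False
    proof (cases "q \<in> p ` V")
      case True
      then show False using VC VC2 q by blast
    next
      case False
      then obtain g g' where g: "g \<in> F" "g \<inter> C \<noteq> {}" "q \<in> path_image (\<gamma> g)"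
        "g' \<in> F" "g' \<inter> C = {}" "q \<in> path_image (\<gamma> g')"
        using q by (auto simp: X1_def X2_def)
      then have "q \<in> p ` (g \<inter> g')" using edge_Int_edge[of g g'] F by blast
      then show False using E_sub[of g] g F False by auto
    qed
  qed
  have un: "X1 \<union> X2 = D F" by (auto simp: X1_def X2_def D_def)
  have "D F \<inter> path_image (\<gamma> e) = {p u, p w}" using D_Int_edge[OF F e(1,2)] e(3) by simp
  moreover have "p u \<in> X1" "p w \<in> X2" using V C by (auto simp: X1_def X2_def)
  ultimately have "X1 \<inter> path_image (\<gamma> e) = {p u}" "X2 \<inter> path_image (\<gamma> e) = {p w}"
    using disj unfolding un[symmetric] by blast+
  moreover have "z \<notin> path_image (\<gamma> e)" "z' \<notin> path_image (\<gamma> e)" using z by (auto simp: D_insert)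
  moreover have "connected_component (- (X1 \<union> X2)) z z'" using z un by simp
  ultimately have "connected_component (- (X1 \<union> X2 \<union> path_image (\<gamma> e))) z z'"
    using connected_component_add_arc_bridge[OF cpt disj arc_edge[OF e(1)]] by blast
  then show ?thesis by (simp add: un D_insert)
qed

text \<open>The walk from \<open>u\<close> to \<open>w\<close> yields a path in the drawing, and
  every path contains an arc with the same ends. This arc is the \<open>P\<close> that closes up
  with the new edge to a Jordan curve.\<close>

lemma insert_cycle:
  assumes F: "F \<subseteq> E" and e: "e \<in> E" "e \<notin> F" "e = {u, w}" and conn: "(u, w) \<in> (edge_rel F)\<^sup>*"
  obtains \<sigma> :: "complex \<Rightarrow> bool" and z w where
    "\<And>z w. z \<notin> D (insert e F) \<Longrightarrow> w \<notin> D (insert e F) \<Longrightarrow> connected_component (- D F) z w \<Longrightarrow>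
      \<sigma> z = \<sigma> w \<Longrightarrow> connected_component (- D (insert e F)) z w"
    "connected_component (- D F) z w" "z \<notin> D (insert e F)" "w \<notin> D (insert e F)"
    "\<not> connected_component (- D (insert e F)) z w"
proof -
  obtain a b where ab: "e = {a, b}" "a \<noteq> b" "a \<in> V" "b \<in> V" "pathstart (\<gamma> e) = p a" "pathfinish (\<gamma> e) = p b"
    using edge_ends[OF e(1)] by blast
  have "(w, u) \<in> (edge_rel F)\<^sup>*" using conn sym_rtrancl[OF sym_edge_rel, of F] by (meson symD)
  then have "(a, b) \<in> (edge_rel F)\<^sup>*" using conn ab(1) e(3) by (auto simp: doubleton_eq_iff)
  then have "path_component (D F) (p a) (p b)" using path_component_D F ab by blast
  then obtain g where g: "path g" "path_image g \<subseteq> D F" "pathstart g = p a" "pathfinish g = p b"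
    by (auto simp: path_component_def)
  have "p a \<noteq> p b" using inj_p ab by (auto dest: inj_onD)
  then obtain P where P: "arc P" "path_image P \<subseteq> path_image g" "pathstart P = p a" "pathfinish P = p b"
    using path_contains_arc[OF g(1,3,4)] by blast
  have "D F \<inter> path_image (\<gamma> e) = {pathstart (\<gamma> e), pathfinish (\<gamma> e)}"
    using D_Int_edge[OF F e(1,2)] ab by simp
  then show ?thesis
    using add_arc_cycle_splits[OF compact_D[OF F] P(1) arc_edge[OF e(1)]] P g ab that
    unfolding D_insert by (metis (no_types, lifting) order_trans)
qed

text \<open>Both kinds of edges take one form: for a bridge the side is constant, since nothing is
  separated.\<close>

lemma insert_splits:
  assumes F: "F \<subseteq> E" and e: "e \<in> E" "e \<notin> F"
  obtains \<sigma> :: "complex \<Rightarrow> bool" where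
    "\<And>z w. z \<notin> D (insert e F) \<Longrightarrow> w \<notin> D (insert e F) \<Longrightarrow> connected_component (- D F) z w \<Longrightarrow>
      \<sigma> z = \<sigma> w \<Longrightarrow> connected_component (- D (insert e F)) z w"
proof -
  obtain u w where uw: "e = {u, w}" using edge_ends[OF e(1)] by blast
  show ?thesis
  proof (cases "(u, w) \<in> (edge_rel F)\<^sup>*")
    case True
    then show ?thesis using insert_cycle[OF F e uw] that by metis
  next
    case False
    then show ?thesis using insert_bridge[OF F e uw] that[of "\<lambda>_. True"] by blast
  qed
qed

lemma components_empty_D: "components (- D {}) = {- D {}}"
proof -
  have "connected (UNIV - p ` V)"
    using finite_V by (intro connected_open_diff_countable) (auto simp: countable_finite)
  then have "connected (- D {})" by (simp add: D_def Compl_eq_Diff_UNIV)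
  moreover have "- D {} \<noteq> {}"
  proof
    assume "- D {} = {}"
    then have "UNIV = p ` V" by (auto simp: D_def)
    then have "finite (UNIV :: complex set)" using finite_imageI[OF finite_V, of p] by simp
    then show False by (simp add: infinite_UNIV_char_0)
  qed
  ultimately show ?thesis by (simp add: components_eq_sing_iff)
qed

text \<open>Each edge at most doubles the number of faces. Finiteness must precede all counting, as
  \<open>card\<close> of an infinite set is 0.\<close>

lemma finite_faces: "F \<subseteq> E \<Longrightarrow> finite (components (- D F))"
proof -
  assume "F \<subseteq> E"
  then have "finite F" using finite_E finite_subset by blast
  then show ?thesis using \<open>F \<subseteq> E\<close>
  proof (induction F rule: finite_induct)
    case empty
    then show ?case by (simp add: components_empty_D)
  next
    case (insert e F)
    then obtain \<sigma> :: "complex \<Rightarrow> bool" where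
      "\<And>z w. z \<notin> D (insert e F) \<Longrightarrow> w \<notin> D (insert e F) \<Longrightarrow> connected_component (- D F) z w \<Longrightarrow>
        \<sigma> z = \<sigma> w \<Longrightarrow> connected_component (- D (insert e F)) z w"
      using insert_splits[of F e] by blast
    then show ?case
      using insert D_mono[of F "insert e F"]
      by (intro finite_components_refine[of "D F" "D (insert e F)" \<sigma>]) auto
  qed
qed

lemma no_open_in_edge:
  assumes "e \<in> E" "open U" "U \<subseteq> - D F" "U \<subseteq> D (insert e F)"
  shows "U = {}"
  using assms open_subset_arc_empty[OF arc_edge[OF assms(1)], of U] by (auto simp: D_insert)

section \<open>Connected components and Euler's inequality\<close>

text \<open>The vertex sets of the connected components of the graph with edge set
  \<open>F\<close>.\<close>

definition "vertex_classes F = (\<lambda>u. (edge_rel F)\<^sup>* `` {u}) ` V"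

text \<open>Closing old classes under the new reachability maps them onto the new ones; a bridge
  makes the classes of \<open>u\<close> and \<open>w\<close> collide.\<close>

lemma vertex_classes_insert:
  assumes "{u, w} \<in> E"
  shows "card (vertex_classes (insert {u, w} F)) \<le> card (vertex_classes F)"
    and "(u, w) \<notin> (edge_rel F)\<^sup>* \<Longrightarrow>
         card (vertex_classes (insert {u, w} F)) < card (vertex_classes F)"
proof -
  let ?R = "edge_rel F" and ?R' = "edge_rel (insert {u, w} F)"
  have sub: "?R\<^sup>* \<subseteq> ?R'\<^sup>*" by (intro rtrancl_mono) (auto simp: edge_rel_def)
  have g: "?R'\<^sup>* `` (?R\<^sup>* `` {x}) = ?R'\<^sup>* `` {x}" for x
    using sub by (auto intro: rtrancl_trans)
  have eq: "vertex_classes (insert {u, w} F) = (\<lambda>A. ?R'\<^sup>* `` A) ` vertex_classes F"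
    unfolding vertex_classes_def image_image g ..
  have fin: "finite (vertex_classes F)" using finite_V by (simp add: vertex_classes_def)
  show le: "card (vertex_classes (insert {u, w} F)) \<le> card (vertex_classes F)"
    unfolding eq using fin by (rule card_image_le)
  assume nc: "(u, w) \<notin> ?R\<^sup>*"
  have uw: "u \<in> V" "w \<in> V" using E_sub[OF assms] by auto
  have "(u, w) \<in> ?R'" "(w, u) \<in> ?R'" by (auto simp: edge_rel_def insert_commute)
  then have "?R'\<^sup>* `` {u} = ?R'\<^sup>* `` {w}" by (auto intro: converse_rtrancl_into_rtrancl)
  then have same: "?R'\<^sup>* `` (?R\<^sup>* `` {u}) = ?R'\<^sup>* `` (?R\<^sup>* `` {w})" unfolding g .
  have "?R\<^sup>* `` {u} \<in> vertex_classes F" "?R\<^sup>* `` {w} \<in> vertex_classes F"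
    using uw by (auto simp: vertex_classes_def)
  moreover have "?R\<^sup>* `` {u} \<noteq> ?R\<^sup>* `` {w}" using nc by auto
  ultimately have "\<not> inj_on (\<lambda>A. ?R'\<^sup>* `` A) (vertex_classes F)"
    using same by (meson inj_onD)
  then have "card ((\<lambda>A. ?R'\<^sup>* `` A) ` vertex_classes F) \<noteq> card (vertex_classes F)"
    using fin by (metis eq_card_imp_inj_on)
  then show "card (vertex_classes (insert {u, w} F)) < card (vertex_classes F)" using le eq by simp
qed

text \<open>Edges are added one at a time. An edge closing a cycle creates a face, and a bridge
  merges two components; either change pays for the edge.\<close>

lemma Euler_inequality:
  assumes "F \<subseteq> E"
  shows "card F + card (vertex_classes F) + 1 \<le> card V + card (components (- D F))"
proof -
  have "finite F" using assms finite_E finite_subset by blast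
  then show ?thesis using assms
  proof (induction F rule: finite_induct)
    case empty
    have "card (vertex_classes {}) \<le> card V"
      unfolding vertex_classes_def using finite_V by (rule card_image_le)
    then show ?case by (simp add: components_empty_D)
  next
    case (insert e F)
    then have F: "F \<subseteq> E" and e: "e \<in> E" "e \<notin> F" by auto
    obtain u w where uw: "e = {u, w}" using edge_ends[OF e(1)] by blast
    have fin: "finite (components (- D (insert e F)))" using insert.prems finite_faces by blast
    have no: "U = {}" if "open U" "U \<subseteq> - D F" "U \<subseteq> D (insert e F)" for U
      using no_open_in_edge[OF e(1) that] .
    note refine = card_components_refine[OF D_mono[OF subset_insertI] closed_D[OF F] no fin]
    have IH: "card F + card (vertex_classes F) + 1 \<le> card V + card (components (- D F))"
      using insert.IH F by blast
    have cF: "card (insert e F) = card F + 1" using insert.hyps by simp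
    show ?case
    proof (cases "(u, w) \<in> (edge_rel F)\<^sup>*")
      case True
      obtain z w' where zw: "connected_component (- D F) z w'" "z \<notin> D (insert e F)" "w' \<notin> D (insert e F)"
        "\<not> connected_component (- D (insert e F)) z w'"
        using insert_cycle[OF F e uw True] by metis
      have "card (components (- D F)) < card (components (- D (insert e F)))"
        using refine(2) zw by blast
      moreover have "card (vertex_classes (insert e F)) \<le> card (vertex_classes F)"
        using vertex_classes_insert(1)[of u w F] e uw by simp
      ultimately show ?thesis using IH cF by linarith
    next
      case False
      have "card (components (- D F)) \<le> card (components (- D (insert e F)))"
        using refine(1) by blast
      moreover have "card (vertex_classes (insert e F)) < card (vertex_classes F)"
        using vertex_classes_insert(2)[of u w F] e uw False by simp
      ultimately show ?thesis using IH cF by linarith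
    qed
  qed
qed

text \<open>Each edge of a forest is a bridge at the moment it is added, and bridges separate
  nothing.\<close>

lemma connected_compl_forest:
  assumes "F \<subseteq> E" "cycles F = {}"
  shows "connected (- D F)"
proof -
  have "finite F" using assms finite_E finite_subset by blast
  then show ?thesis using assms
  proof (induction F rule: finite_induct)
    case empty
    show ?case using components_empty_D by (metis in_components_connected singletonI)
  next
    case (insert e F)
    then have F: "F \<subseteq> E" and e: "e \<in> E" "e \<notin> F" by auto
    obtain u w where uw: "e = {u, w}" "u \<noteq> w" using E_card[OF e(1)] by (auto simp: card_2_iff)
    have "cycles F = {}" using insert.prems(2) cycles_mono[of F "insert e F"] by blast
    then have con: "connected (- D F)" using insert.IH F by blast
    have nc: "(u, w) \<notin> (edge_rel F)\<^sup>*"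
      using ex_cycle_if_connected[of u w F] insert.prems(2) uw e by auto
    have "connected_component (- D (insert e F)) z z'"
      if "z \<in> - D (insert e F)" "z' \<in> - D (insert e F)" for z z'
    proof -
      have "connected_component (- D F) z z'"
        unfolding connected_component_def using con that D_mono[OF subset_insertI, of F e] by blast
      then show ?thesis using insert_bridge[OF F e uw(1) nc] that by blast
    qed
    then show ?case by (simp add: connected_iff_connected_component)
  qed
qed

section \<open>Boundaries of faces and the edge bound\<close>

text \<open>The ends of the arc are removed because the frontier of a face may touch an edge merely
  at a vertex.\<close>

definition boundary :: "complex set \<Rightarrow> 'a set set" where
  "boundary K = {e \<in> E. frontier K \<inter> (path_image (\<gamma> e) - p ` e) \<noteq> {}}"

lemma boundary_sub: "boundary K \<subseteq> E"
  by (auto simp: boundary_def)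

text \<open>The frontier of \<open>K\<close> is contained in the drawing of
  \<open>boundary K\<close>. A connected set avoiding that drawing therefore cannot leave
  \<open>K\<close>.\<close>

lemma face_of_boundary:
  assumes "K \<in> components (- D E)"
  shows "K \<in> components (- D (boundary K))"
proof -
  have sub: "frontier K \<subseteq> D (boundary K)"
  proof
    fix q assume q: "q \<in> frontier K"
    then have "q \<in> D E" using frontier_of_components_closed_complement[OF closed_D assms] by auto
    then consider "q \<in> p ` V" | e where "e \<in> E" "q \<in> path_image (\<gamma> e)" "q \<notin> p ` V" by (auto simp: D_def)
    then show "q \<in> D (boundary K)"
    proof cases
      case 2
      then have "q \<notin> p ` e" using E_sub by blast
      then have "e \<in> boundary K" using 2 q by (auto simp: boundary_def)
      then show ?thesis using 2 by (auto simp: D_def)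
    qed (auto simp: D_def)
  qed
  have KD: "K \<subseteq> - D (boundary K)"
    using in_components_subset[OF assms] D_mono[OF boundary_sub] by blast
  obtain z where z: "z \<in> K" using in_components_nonempty[OF assms] by blast
  let ?L = "connected_component_set (- D (boundary K)) z"
  have "K \<subseteq> ?L"
    using in_components_connected[OF assms] KD z by (intro connected_component_maximal) auto
  moreover have "?L \<subseteq> K"
  proof (rule ccontr)
    assume "\<not> ?L \<subseteq> K"
    moreover have "z \<in> ?L" using z KD by (simp add: subset_eq)
    then have "?L \<inter> K \<noteq> {}" using z by blast
    ultimately have "?L \<inter> frontier K \<noteq> {}"
      by (intro connected_Int_frontier connected_connected_component) auto
    then show False using sub connected_component_subset by blast
  qed
  ultimately show ?thesis using z KD by (auto simp: components_def)
qed

text \<open>If the boundary were a forest, its complement would be connected and hence equal to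
  \<open>K\<close>, leaving no room for a second face.\<close>

lemma boundary_contains_cycle:
  assumes "K \<in> components (- D E)" "2 \<le> card (components (- D E))"
  shows "cycles (boundary K) \<noteq> {}"
proof
  assume "cycles (boundary K) = {}"
  then have "connected (- D (boundary K))" using connected_compl_forest boundary_sub by blast
  moreover have "- D (boundary K) \<noteq> {}"
    using face_of_boundary[OF assms(1)] in_components_nonempty in_components_subset by blast
  ultimately have "components (- D (boundary K)) = {- D (boundary K)}" by (simp add: components_eq_sing_iff)
  then have K: "K = - D (boundary K)" using face_of_boundary[OF assms(1)] by blast
  have "components (- D E) \<subseteq> {K}"
  proof
    fix L assume L: "L \<in> components (- D E)"
    have "L \<subseteq> K" using K in_components_subset[OF L] D_mono[OF boundary_sub, of K] by blast
    then have "L \<inter> K \<noteq> {}" using in_components_nonempty[OF L] by blast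
    then show "L \<in> {K}" using components_eq[OF L assms(1)] by blast
  qed
  then have "card (components (- D E)) \<le> card {K}" by (intro card_mono) auto
  then show False using assms(2) by simp
qed

text \<open>The edge without its ends is connected and misses the drawing of \<open>E - {e}\<close>,
  so all faces at it come from one component, which is split into at most two.\<close>

lemma card_faces_at_edge:
  assumes "e \<in> E"
  shows "card {K \<in> components (- D E). e \<in> boundary K} \<le> 2"
proof -
  let ?F = "E - {e}"
  have ins: "insert e ?F = E" using assms by blast
  obtain \<sigma> :: "complex \<Rightarrow> bool" where \<sigma>:
    "\<And>z w. z \<notin> D (insert e ?F) \<Longrightarrow> w \<notin> D (insert e ?F) \<Longrightarrow> connected_component (- D ?F) z w \<Longrightarrow>
      \<sigma> z = \<sigma> w \<Longrightarrow> connected_component (- D (insert e ?F)) z w"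
    using insert_splits[of ?F e] assms by blast
  let ?A = "path_image (\<gamma> e) - p ` e"
  have "connected ?A"
    using connected_simple_path_endless[OF arc_imp_simple_path[OF arc_edge[OF assms]]] ends_edge[OF assms]
    by simp
  moreover have "?A \<inter> D ?F = {}" using D_Int_edge[of ?F e] assms by blast
  ultimately have "card {K \<in> components (- D E). frontier K \<inter> ?A \<noteq> {}} \<le> 2"
    using card_components_touching[OF closed_D[of ?F] D_mono[of ?F E], of ?A \<sigma>] \<sigma> unfolding ins by blast
  then show ?thesis using assms by (simp add: boundary_def)
qed

text \<open>Without \<open>e\<close> the complement is connected, so the two values of \<sigma>
  bound the number of faces. This is applied to a 4-cycle that bounds two faces.\<close>

lemma card_faces_cycle_le_2:
  assumes "e \<in> F" "F \<subseteq> E" "cycles (F - {e}) = {}"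
  shows "card (components (- D F)) \<le> 2"
proof -
  let ?F = "F - {e}"
  have ins: "insert e ?F = F" using assms by blast
  have con: "connected (- D ?F)" using connected_compl_forest[of ?F] assms by blast
  obtain \<sigma> :: "complex \<Rightarrow> bool" where \<sigma>:
    "\<And>z w. z \<notin> D (insert e ?F) \<Longrightarrow> w \<notin> D (insert e ?F) \<Longrightarrow> connected_component (- D ?F) z w \<Longrightarrow>
      \<sigma> z = \<sigma> w \<Longrightarrow> connected_component (- D (insert e ?F)) z w"
    using insert_splits[of ?F e] assms by blast
  have "\<forall>K\<in>components (- D F). \<exists>z. z \<in> K" using in_components_nonempty by blast
  then obtain r where r: "\<And>K. K \<in> components (- D F) \<Longrightarrow> r K \<in> K" by metis
  have rD: "r K \<notin> D F" if "K \<in> components (- D F)" for K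
    using r[OF that] in_components_subset[OF that] by auto
  have "inj_on (\<lambda>K. \<sigma> (r K)) (components (- D F))"
  proof (rule inj_onI)
    fix K L assume K: "K \<in> components (- D F)" and L: "L \<in> components (- D F)" and eq: "\<sigma> (r K) = \<sigma> (r L)"
    have "connected_component (- D ?F) (r K) (r L)"
      unfolding connected_component_def using con rD K L D_mono[of ?F F] by blast
    then have "connected_component (- D F) (r K) (r L)" using \<sigma> rD K L eq unfolding ins by blast
    then have "connected_component_set (- D F) (r K) = connected_component_set (- D F) (r L)"
      by (simp add: connected_component_eq)
    then show "K = L" using component_of_point r K L by metis
  qed
  then show ?thesis using card_inj_on_le[of _ "components (- D F)" "UNIV :: bool set"] by auto
qed

lemma sum_boundary_le: "(\<Sum>K\<in>components (- D E). card (boundary K)) \<le> 2 * card E"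
proof -
  let ?\<Phi> = "components (- D E)"
  have fin: "finite ?\<Phi>" using finite_faces by blast
  have "(\<Sum>K\<in>?\<Phi>. card (boundary K)) = (\<Sum>K\<in>?\<Phi>. \<Sum>e\<in>{e. e \<in> E \<and> e \<in> boundary K}. 1)"
    using boundary_sub by (intro sum.cong refl) (simp add: Collect_conj_eq Int_absorb1)
  also have "\<dots> = (\<Sum>e\<in>E. \<Sum>K\<in>{K. K \<in> ?\<Phi> \<and> e \<in> boundary K}. 1)"
    by (rule sum.swap_restrict[OF fin finite_E])
  also have "\<dots> \<le> (\<Sum>e\<in>E. 2)" using card_faces_at_edge by (intro sum_mono) simp
  finally show ?thesis by simp
qed

text \<open>Write \<open>e\<close>, \<open>f\<close> and \<open>q\<close> for the numbers of edges,
  faces and faces with exactly four boundary edges. Counting boundaries gives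
  \<open>5 f \<le> 2 e + q\<close>, and \<open>4 q \<le> e\<close> because quadrilaterals have
  disjoint boundaries. Hence \<open>20 f \<le> 9 e\<close>, and Euler's inequality turns this into
  \<open>11 e \<le> 20 n\<close>.\<close>

lemma card_edges_le:
  assumes girth: "4 \<le> girth E"
    and nonadj: "\<forall>C\<in>cycles_of_length 4 E. \<forall>C'\<in>cycles_of_length 4 E. \<not> adjacent_cycles C C'"
  shows "11 * card E \<le> 20 * card V"
proof (cases "card (components (- D E)) \<le> 2")
  case True
  \<comment> \<open>With at most two faces and at least one component, Euler's inequality alone
    suffices. This case is separate because a single face need not have a cycle on its boundary and
    two faces may share a 4-cycle.\<close>
  have "card E \<le> card V"
  proof (cases "V = {}")
    case True
    have "E = {}"
    proof (rule ccontr)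
      assume "E \<noteq> {}"
      then obtain e where "e \<in> E" by blast
      then show False using E_sub[of e] E_card[of e] True by simp
    qed
    then show ?thesis by simp
  next
    case False
    then have "card (vertex_classes E) \<noteq> 0" using finite_V by (simp add: vertex_classes_def)
    then show ?thesis using Euler_inequality[OF order_refl] True by linarith
  qed
  then show ?thesis by simp
next
  case False
  let ?\<Phi> = "components (- D E)"
  have fin: "finite ?\<Phi>" using finite_faces by blast
  have f3: "3 \<le> card ?\<Phi>" using False by simp
  have cyc4: "4 \<le> card C" if "C \<in> cycles F" "F \<subseteq> E" for C F
  proof -
    have "C \<in> cycles E" using that cycles_mono by blast
    then have "girth E \<le> enat (card C)" unfolding girth_def by (rule INF_lower)
    then have "4 \<le> enat (card C)" using girth by (rule order_trans[rotated])
    then show ?thesis by (metis enat_ord_simps(1) numeral_eq_enat)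
  qed
  have finb: "finite (boundary K)" for K using boundary_sub finite_E finite_subset by blast
  have bcyc: "\<exists>C\<in>cycles (boundary K). C \<subseteq> boundary K \<and> 4 \<le> card C" if "K \<in> ?\<Phi>" for K
  proof -
    have "cycles (boundary K) \<noteq> {}" using boundary_contains_cycle[OF that] f3 by simp
    then obtain C where C: "C \<in> cycles (boundary K)" by blast
    moreover have "C \<subseteq> boundary K" using C by (auto simp: cycles_def)
    ultimately show ?thesis using cyc4[OF C boundary_sub] by blast
  qed
  have b4: "4 \<le> card (boundary K)" if "K \<in> ?\<Phi>" for K
    using bcyc[OF that] card_mono[OF finb] by (meson order_trans)
  define \<Phi>4 where "\<Phi>4 = {K \<in> ?\<Phi>. card (boundary K) = 4}"
  have is_cycle: "boundary K \<in> cycles_of_length 4 E" if K: "K \<in> \<Phi>4" for K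
  proof -
    obtain C where C: "C \<in> cycles (boundary K)" "C \<subseteq> boundary K" "4 \<le> card C"
      using bcyc K by (auto simp: \<Phi>4_def)
    have "card (boundary K) = 4" using K by (simp add: \<Phi>4_def)
    then have "C = boundary K" using C card_seteq[OF finb, of C K] by simp
    moreover have "C \<in> cycles E" using C(1) cycles_mono[OF boundary_sub] by blast
    ultimately show ?thesis using \<open>card (boundary K) = 4\<close> by (simp add: cycles_of_length_def)
  qed
  \<comment> \<open>Two quadrilaterals with a common edge have the same 4-cycle as boundary, as
    distinct ones would be adjacent. Then they are the only faces of the whole drawing, against
    \<open>f3\<close>.\<close>
  have disj: "boundary K \<inter> boundary L = {}" if KL: "K \<in> \<Phi>4" "L \<in> \<Phi>4" "K \<noteq> L" for K L
  proof (rule ccontr)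
    assume "boundary K \<inter> boundary L \<noteq> {}"
    moreover from this have "boundary K = boundary L"
      using nonadj is_cycle[OF KL(1)] is_cycle[OF KL(2)] by (auto simp: adjacent_cycles_def)
    ultimately obtain e where e: "e \<in> boundary K" and eq: "boundary K = boundary L" by blast
    \<comment> \<open>Three edges cannot contain a cycle, which has at least four, so the 4-cycle
      minus \<open>e\<close> is a forest.\<close>
    have "card (boundary K - {e}) = 3" using e KL(1) by (simp add: \<Phi>4_def)
    moreover have "card C \<le> card (boundary K - {e})" if "C \<in> cycles (boundary K - {e})" for C
      using that finb[of K] by (intro card_mono) (auto simp: cycles_def)
    ultimately have "cycles (boundary K - {e}) = {}"
      using cyc4[of _ "boundary K - {e}"] boundary_sub[of K] by (metis (no_types, lifting) Diff_subset
          all_not_in_conv numeral_le_iff order_trans semiring_norm(69) semiring_norm(72))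
    then have c2: "card (components (- D (boundary K))) \<le> 2"
      using card_faces_cycle_le_2[OF e boundary_sub] by blast
    have \<Phi>: "K \<in> ?\<Phi>" "L \<in> ?\<Phi>" using KL by (auto simp: \<Phi>4_def)
    have inC: "K \<in> components (- D (boundary K))" "L \<in> components (- D (boundary K))"
      using face_of_boundary \<Phi> eq by metis+
    have "{K, L} = components (- D (boundary K))"
      using finite_faces[OF boundary_sub] inC c2 KL(3) by (intro card_seteq) auto
    then have un: "- D (boundary K) = K \<union> L" using Union_components[of "- D (boundary K)"] by blast
    have "?\<Phi> \<subseteq> {K, L}"
    proof
      fix M assume M: "M \<in> ?\<Phi>"
      have "M \<subseteq> K \<union> L" using un in_components_subset[OF M] D_mono[OF boundary_sub, of K] by blast
      then have "M \<inter> K \<noteq> {} \<or> M \<inter> L \<noteq> {}" using in_components_nonempty[OF M] by blast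
      then show "M \<in> {K, L}" using components_eq[OF M] \<Phi> by blast
    qed
    then have "card ?\<Phi> \<le> card {K, L}" by (intro card_mono) auto
    then show False using f3 KL(3) by simp
  qed
  have fin4: "finite \<Phi>4" using fin by (simp add: \<Phi>4_def)
  have "4 * card \<Phi>4 = (\<Sum>K\<in>\<Phi>4. card (boundary K))" by (simp add: \<Phi>4_def)
  also have "\<dots> = card (\<Union>K\<in>\<Phi>4. boundary K)"
    using fin4 finb disj by (intro card_UN_disjoint[symmetric]) auto
  also have "\<dots> \<le> card E" using finite_E boundary_sub by (intro card_mono) auto
  finally have e4: "4 * card \<Phi>4 \<le> card E" .
  have "5 * card ?\<Phi> = (\<Sum>K\<in>?\<Phi>. 5)" by simp
  also have "\<dots> \<le> (\<Sum>K\<in>?\<Phi>. card (boundary K) + of_bool (card (boundary K) = 4))"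
  proof (rule sum_mono)
    fix K assume "K \<in> ?\<Phi>"
    then show "5 \<le> card (boundary K) + of_bool (card (boundary K) = 4)" using b4[of K] by auto
  qed
  also have "\<dots> = (\<Sum>K\<in>?\<Phi>. card (boundary K)) + card \<Phi>4"
    using fin by (simp add: sum.distrib of_bool_def sum.If_cases \<Phi>4_def Int_def)
  finally have "5 * card ?\<Phi> \<le> 2 * card E + card \<Phi>4" using sum_boundary_le by linarith
  then show ?thesis using e4 Euler_inequality[of E] by simp
qed

end

section \<open>Equitable tree-colourings of sparse triangle-free graphs\<close>

definition color_class :: "('a \<Rightarrow> nat) \<Rightarrow> 'a set \<Rightarrow> nat \<Rightarrow> 'a set" where
  "color_class c S i = {v \<in> S. c v = i}"

lemma finite_color_class [simp]: "finite S \<Longrightarrow> finite (color_class c S i)"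
  by (simp add: color_class_def)

text \<open>Integers allow a class to lose a vertex; if \<open>z\<close> already has colour
  \<open>j\<close>, the two corrections cancel.\<close>

lemma int_card_class_recolor:
  assumes "finite S" "z \<in> S"
  shows "int (card (color_class (c(z := j)) S k)) =
         int (card (color_class c S k)) + of_bool (k = j) - of_bool (k = c z)"
proof -
  have D: "color_class (c(z := j)) S k - {z} = color_class c S k - {z}"
    by (auto simp: color_class_def)
  have 1: "int (card (color_class c' S k)) = int (card (color_class c' S k - {z})) + of_bool (k = c' z)"
    for c' :: "'a \<Rightarrow> nat"
  proof (cases "c' z = k")
    case True
    then have "z \<in> color_class c' S k" using assms by (simp add: color_class_def)
    then have "card (color_class c' S k) = Suc (card (color_class c' S k - {z}))"
      using assms by (intro card.remove) auto
    then show ?thesis using True by simp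
  next
    case False
    then have "z \<notin> color_class c' S k" by (simp add: color_class_def)
    then show ?thesis using False by simp
  qed
  show ?thesis using 1[of "c(z := j)"] 1[of c] D by simp
qed

lemma color_class_insert:
  assumes "v \<notin> S"
  shows "color_class (c(v := j)) (insert v S) k =
         (if k = j then insert v (color_class c S k) else color_class c S k)"
  using assms by (auto simp: color_class_def)

lemma int_card_class_insert:
  assumes "finite S" "v \<notin> S"
  shows "int (card (color_class (c(v := j)) (insert v S) k)) =
         int (card (color_class c S k)) + of_bool (k = j)"
proof -
  have "v \<notin> color_class c S j" using assms by (simp add: color_class_def)
  then show ?thesis using assms by (simp add: color_class_insert)
qed

lemma card_eq_sum_classes:
  assumes "finite S" "\<forall>v\<in>S. c v < t"
  shows "card S = (\<Sum>i<t. card (color_class c S i))"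
proof -
  have "S = (\<Union>i<t. color_class c S i)" using assms by (auto simp: color_class_def)
  then have "card S = card (\<Union>i<t. color_class c S i)" by simp
  also have "\<dots> = (\<Sum>i<t. card (color_class c S i))"
    using assms by (intro card_UN_disjoint) (auto simp: color_class_def)
  finally show ?thesis .
qed

text \<open>Meant for the neighbours of a vertex, all giving at least \<open>m\<close> except
  perhaps one that gives only \<open>p\<close>. If \<open>Q\<close> is empty, any element can act as
  the exception because \<open>p \<le> m\<close>.\<close>

lemma sum_ge_one_exception:
  fixes f :: "'a \<Rightarrow> real"
  assumes "finite A" "Q \<subseteq> A" "card Q \<le> 1" "A \<noteq> {}" "p \<le> m"
    and "\<And>w. w \<in> A - Q \<Longrightarrow> m \<le> f w" "\<And>w. w \<in> Q \<Longrightarrow> p \<le> f w"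
  shows "(real (card A) - 1) * m + p \<le> sum f A"
proof -
  obtain q where q: "q \<in> A" "Q \<subseteq> {q}"
  proof (cases "Q = {}")
    case True
    then show ?thesis using assms(4) that by blast
  next
    case False
    then have "card Q = 1" using assms(1,2,3) finite_subset[OF assms(2,1)] by (simp add: le_Suc_eq)
    then show ?thesis using that assms(2) by (auto simp: card_1_singleton_iff)
  qed
  have fq: "p \<le> f q" using q assms(5) assms(6)[of q] assms(7)[of q] by (cases "q \<in> Q") auto
  have "real (card (A - {q})) * m \<le> sum f (A - {q})"
    using q assms(6) by (intro sum_bounded_below) auto
  moreover have "real (card (A - {q})) = real (card A) - 1"
    using q assms(1) card.remove[of A q] by simp
  moreover have "sum f A = f q + sum f (A - {q})" using sum.remove[OF assms(1) q(1)] .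
  ultimately show ?thesis using fq by simp
qed

text \<open>The degree sum is twice the number of edges, so \<open>sparse\<close> says that every
  induced subgraph has at most \<open>20/11\<close> edges per vertex. Acyclicity enters through
  heredity and the addition of a vertex with at most one neighbour.\<close>

locale sparse_triangle_free =
  fixes N :: "'a \<Rightarrow> 'a set" and acyc :: "'a set \<Rightarrow> bool" and V :: "'a set"
  assumes N_sym: "w \<in> N v \<Longrightarrow> v \<in> N w"
    and N_irrefl: "v \<notin> N v"
    and triangle_free: "u \<in> N v \<Longrightarrow> w \<in> N v \<Longrightarrow> w \<notin> N u"
    and acyc_empty: "acyc {}"
    and acyc_subset: "acyc B \<Longrightarrow> A \<subseteq> B \<Longrightarrow> acyc A"
    and acyc_insert: "acyc A \<Longrightarrow> finite A \<Longrightarrow> card (N v \<inter> A) \<le> 1 \<Longrightarrow> acyc (insert v A)"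
    and finite_V: "finite V"
    and sparse: "S \<subseteq> V \<Longrightarrow> 11 * (\<Sum>v\<in>S. card (N v \<inter> S)) \<le> 40 * card S"
begin

lemma finite_sub: "S \<subseteq> V \<Longrightarrow> finite S"
  using finite_V finite_subset by blast

text \<open>Neighbours of \<open>x\<close> that are isolated in \<open>S\<close> become leaves when \<open>x\<close> is added.\<close>

lemma acyc_insert_isolated:
  assumes "acyc S" "finite S" "card {w \<in> N x \<inter> S. N w \<inter> S \<noteq> {}} \<le> 1"
  shows "acyc (insert x S)"
proof -
  define I where "I = {w \<in> N x \<inter> S. N w \<inter> S = {}}"
  have fI: "finite I" using assms(2) by (simp add: I_def)
  have "N x \<inter> (S - I) = {w \<in> N x \<inter> S. N w \<inter> S \<noteq> {}}" by (auto simp: I_def)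
  then have "acyc (insert x (S - I))"
    using assms by (intro acyc_insert) (auto intro: acyc_subset)
  moreover have "J \<subseteq> I \<Longrightarrow> acyc (insert x (S - I) \<union> J)" if "finite J" for J
    using that
  proof (induction J rule: finite_induct)
    case empty
    then show ?case using \<open>acyc (insert x (S - I))\<close> by simp
  next
    case (insert j J)
    have "N j \<inter> (insert x (S - I) \<union> J) \<subseteq> {x}"
      using insert.prems by (auto simp: I_def)
    then have "card (N j \<inter> (insert x (S - I) \<union> J)) \<le> card {x}" by (intro card_mono) auto
    then have "acyc (insert j (insert x (S - I) \<union> J))"
      using insert assms(2) by (intro acyc_insert) auto
    then show ?case by simp
  qed
  ultimately have "acyc (insert x (S - I) \<union> I)" using fI by blast
  then show ?thesis by (rule acyc_subset) auto
qed

section \<open>Colourings and the three-vertex reduction\<close>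

definition tree_coloring :: "nat \<Rightarrow> ('a \<Rightarrow> nat) \<Rightarrow> 'a set \<Rightarrow> bool" where
  "tree_coloring t c S \<longleftrightarrow> (\<forall>v\<in>S. c v < t) \<and> (\<forall>i<t. acyc (color_class c S i))"

definition equitable :: "nat \<Rightarrow> ('a \<Rightarrow> nat) \<Rightarrow> 'a set \<Rightarrow> bool" where
  "equitable t c S \<longleftrightarrow>
     (\<forall>i<t. \<forall>j<t. card (color_class c S i) \<le> card (color_class c S j) + 1)"

definition equitably_colorable :: "nat \<Rightarrow> 'a set \<Rightarrow> bool" where
  "equitably_colorable t S \<longleftrightarrow> (\<exists>c. tree_coloring t c S \<and> equitable t c S)"

lemma tree_coloring_insert:
  assumes "tree_coloring t c S" "finite S" "v \<notin> S" "j < t"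
    and "card (N v \<inter> color_class c S j) \<le> 1"
  shows "tree_coloring t (c(v := j)) (insert v S)"
  using assms unfolding tree_coloring_def
  by (auto simp: color_class_insert acyc_insert)

lemma tree_coloring_recolor:
  assumes "tree_coloring t c S" "finite S" "z \<in> S" "j < t"
    and "card (N z \<inter> color_class c S j) \<le> 1"
  shows "tree_coloring t (c(z := j)) S"
  unfolding tree_coloring_def
proof (intro conjI ballI allI impI)
  fix i assume "i < t"
  show "acyc (color_class (c(z := j)) S i)"
  proof (cases "i = j")
    case True
    have "acyc (insert z (color_class c S j))"
      using assms by (intro acyc_insert) (auto simp: tree_coloring_def)
    then show ?thesis by (rule acyc_subset) (auto simp: color_class_def True)
  next
    case False
    have "acyc (color_class c S i)" using assms \<open>i < t\<close> by (auto simp: tree_coloring_def)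
    then show ?thesis by (rule acyc_subset) (use False in \<open>auto simp: color_class_def\<close>)
  qed
qed (use assms in \<open>auto simp: tree_coloring_def\<close>)

text \<open>The average degree is at most \<open>40/11 < 4\<close>.\<close>

lemma ex_degree_le_3:
  assumes "S \<subseteq> V" "S \<noteq> {}"
  shows "\<exists>v\<in>S. card (N v \<inter> S) \<le> 3"
proof (rule ccontr)
  assume "\<not> ?thesis"
  then have "4 \<le> card (N v \<inter> S)" if "v \<in> S" for v using that by force
  then have "(\<Sum>v\<in>S. 4) \<le> (\<Sum>v\<in>S. card (N v \<inter> S))" by (intro sum_mono) auto
  then have "4 * card S \<le> (\<Sum>v\<in>S. card (N v \<inter> S))" by simp
  moreover have "card S > 0" using assms finite_sub by (simp add: card_gt_0_iff)
  ultimately show False using sparse[OF assms(1)] by linarith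
qed

text \<open>Read contrapositively: a vertex with fewer than \<open>2 * card K\<close> neighbours has
  at most one in some class of \<open>K\<close> and can join it.\<close>

lemma card_nbrs_disjoint_classes:
  assumes "finite S" "K \<subseteq> {..<t}" "\<forall>i\<in>K. 2 \<le> card (N v \<inter> color_class c S i)"
  shows "2 * card K \<le> card (N v \<inter> S)"
proof -
  have fK: "finite K" using assms(2) finite_subset by blast
  have "2 * card K = (\<Sum>i\<in>K. 2)" by simp
  also have "\<dots> \<le> (\<Sum>i\<in>K. card (N v \<inter> color_class c S i))" using assms by (intro sum_mono) auto
  also have "\<dots> = card (\<Union>i\<in>K. N v \<inter> color_class c S i)"
    using assms fK by (subst card_UN_disjoint) (auto simp: color_class_def)
  also have "\<dots> \<le> card (N v \<inter> S)"
    using assms by (intro card_mono) (auto simp: color_class_def)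
  finally show ?thesis .
qed

lemma insert_into_small_class:
  assumes "tree_coloring t c S" "finite S" "v \<notin> S" "K \<subseteq> {..<t}"
    and few: "card (N v \<inter> S) < 2 * card K"
  obtains j where "j \<in> K" "tree_coloring t (c(v := j)) (insert v S)"
proof -
  have "\<exists>j\<in>K. card (N v \<inter> color_class c S j) < 2"
    using card_nbrs_disjoint_classes[OF assms(2,4), of v c] few by force
  then obtain j where j: "j \<in> K" "card (N v \<inter> color_class c S j) < 2" by blast
  then have "tree_coloring t (c(v := j)) (insert v S)"
    using assms by (intro tree_coloring_insert) auto
  with j that show ?thesis by blast
qed

lemma equitably_colorable_if_equal:
  assumes "tree_coloring t c S" "\<And>k. k < t \<Longrightarrow> int (card (color_class c S k)) = s"
  shows "equitably_colorable t S"
proof -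
  have "card (color_class c S i) \<le> card (color_class c S j) + 1" if "i < t" "j < t" for i j
    using assms(2)[OF that(1)] assms(2)[OF that(2)] by linarith
  then show ?thesis using assms(1) by (auto simp: equitably_colorable_def equitable_def)
qed

text \<open>\<open>m\<close> is the smallest size and \<open>K\<close> the set of classes attaining
  it, so \<open>K\<close> is never empty and comprises all classes when the sizes agree.\<close>

lemma equitable_class_sizes:
  assumes "finite S" "tree_coloring t c S" "equitable t c S" "0 < t"
  obtains m K where "K \<subseteq> {..<t}" "K \<noteq> {}" "\<And>i. i \<in> K \<Longrightarrow> card (color_class c S i) = m"
    "\<And>i. i < t \<Longrightarrow> i \<notin> K \<Longrightarrow> card (color_class c S i) = m + 1"
    "card S + card K = t * (m + 1)"
proof -
  define m where "m = Min ((\<lambda>i. card (color_class c S i)) ` {..<t})"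
  define K where "K = {i. i < t \<and> card (color_class c S i) = m}"
  have "m \<in> (\<lambda>i. card (color_class c S i)) ` {..<t}"
    unfolding m_def using assms(4) by (intro Min_in) auto
  then obtain i0 where i0: "i0 < t" "card (color_class c S i0) = m" by auto
  have ge: "m \<le> card (color_class c S i)" if "i < t" for i
    unfolding m_def using that by (intro Min_le) auto
  have le: "card (color_class c S i) \<le> m + 1" if "i < t" for i
    using assms(3) that i0 unfolding equitable_def by metis
  have K1: "card (color_class c S i) = m + 1" if "i < t" "i \<notin> K" for i
    using ge[OF that(1)] le[OF that(1)] that by (auto simp: K_def)
  have "card S + card K = (\<Sum>i<t. card (color_class c S i)) + (\<Sum>i<t. of_bool (i \<in> K))"
  proof -
    have "{i. i < t \<and> i \<in> K} = K" by (auto simp: K_def)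
    then have "(\<Sum>i<t. of_bool (i \<in> K)) = card K"
      by (simp add: of_bool_def sum.If_cases) (simp add: Int_def)
    then show ?thesis using card_eq_sum_classes[of S c t] assms by (simp add: tree_coloring_def)
  qed
  also have "\<dots> = (\<Sum>i<t. m + 1)"
    unfolding sum.distrib[symmetric] using K1 by (intro sum.cong) (auto simp: K_def)
  finally have "card S + card K = t * (m + 1)" by simp
  moreover have "K \<noteq> {}" using i0 by (auto simp: K_def)
  moreover have "K \<subseteq> {..<t}" "\<And>i. i \<in> K \<Longrightarrow> card (color_class c S i) = m" by (auto simp: K_def)
  ultimately show ?thesis using that K1 by blast
qed

text \<open>The bounds 1, 3, 5 are \<open>2 k - 1\<close> for \<open>k = 1, 2, 3\<close> available
  classes: \<open>v3\<close> chooses among three short classes, \<open>v2\<close> among the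
  remaining two, and \<open>v1\<close> takes the last. Since the classes differ, edges among the
  three vertices do no harm.\<close>

lemma three_vertex_reduction:
  assumes "finite S" "3 \<le> t" "card S = t * s"
    and in_S: "v1 \<in> S" "v2 \<in> S" "v3 \<in> S" and dist: "v1 \<noteq> v2" "v1 \<noteq> v3" "v2 \<noteq> v3"
    and n1: "card (N v1 \<inter> (S - {v1, v2, v3})) \<le> 1"
    and n2: "card (N v2 \<inter> (S - {v1, v2, v3})) \<le> 3"
    and n3: "card (N v3 \<inter> (S - {v1, v2, v3})) \<le> 5"
    and IH: "equitably_colorable t (S - {v1, v2, v3})"
  shows "equitably_colorable t S"
proof -
  let ?S = "S - {v1, v2, v3}"
  obtain c where c: "tree_coloring t c ?S" "equitable t c ?S"
    using IH by (auto simp: equitably_colorable_def)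
  obtain m K where K: "K \<subseteq> {..<t}" "K \<noteq> {}" "\<And>i. i \<in> K \<Longrightarrow> card (color_class c ?S i) = m"
    "\<And>i. i < t \<Longrightarrow> i \<notin> K \<Longrightarrow> card (color_class c ?S i) = m + 1"
    "card ?S + card K = t * (m + 1)"
  proof (rule equitable_class_sizes[of ?S t c])
    show "finite ?S" "0 < t" using assms by auto
  qed (use c in auto)
  have fK: "finite K" using K(1) finite_subset by blast
  have "card {v1, v2, v3} = 3" using dist by simp
  then have cS: "card ?S = t * s - 3" "3 \<le> t * s"
    using assms(1,3) in_S card_mono[of S "{v1,v2,v3}"] by (auto simp: card_Diff_subset)
  have "card K \<le> t" using K(1) card_mono[of "{..<t}" K] by simp
  moreover have "card K > 0" using K fK by (simp add: card_gt_0_iff)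
  moreover have "t * s + card K = t * (m + 1) + 3" using K(5) cS by linarith
  \<comment> \<open>The number of short classes is congruent to 3 modulo \<open>t\<close> and lies
    between 1 and \<open>t\<close>, so it is 3.\<close>
  ultimately have cK: "card K = 3"
  proof -
    assume a: "card K \<le> t" "card K > 0" "t * s + card K = t * (m + 1) + 3"
    have "int t * (int s - int m - 1) = 3 - int (card K)"
    proof -
      have "int (t * s + card K) = int (t * (m + 1) + 3)" using a(3) by simp
      then show ?thesis by (simp add: algebra_simps)
    qed
    then have dv: "int t dvd 3 - int (card K)" by (metis dvd_triv_left)
    have "\<bar>3 - int (card K)\<bar> < int t" using a assms(2) by linarith
    then have "3 - int (card K) = 0" using dv by (metis dvd_imp_le_int abs_of_nat not_le)
    then show ?thesis by simp
  qed
  have f: "finite ?S" using assms(1) by simp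
  obtain k3 where k3: "k3 \<in> K" "tree_coloring t (c(v3 := k3)) (insert v3 ?S)"
    using insert_into_small_class[OF c(1) f, of v3 K] n3 cK K(1) by auto
  let ?c3 = "c(v3 := k3)" let ?S3 = "insert v3 ?S"
  have "\<exists>j\<in>K - {k3}. card (N v2 \<inter> color_class c ?S j) < 2"
    using card_nbrs_disjoint_classes[OF f, of "K - {k3}" t v2 c] n2 cK K(1) fK k3(1) by force
  then obtain k2 where k2: "k2 \<in> K - {k3}" "card (N v2 \<inter> color_class c ?S k2) < 2" by blast
  have cl2: "color_class ?c3 ?S3 k2 = color_class c ?S k2"
    using k2 by (subst color_class_insert) auto
  let ?c2 = "?c3(v2 := k2)" let ?S2 = "insert v2 ?S3"
  have t2: "tree_coloring t ?c2 ?S2"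
    by (rule tree_coloring_insert[OF k3(2)]) (use f dist k2 K(1) cl2 in auto)
  have "card (K - {k3, k2}) = 1" using cK k3 k2 fK by (simp add: card_Diff_subset)
  then obtain k1 where k1: "K - {k3, k2} = {k1}" by (auto simp: card_1_singleton_iff)
  have cl1: "color_class ?c2 ?S2 k1 = color_class c ?S k1"
  proof -
    have "k1 \<noteq> k2" "k1 \<noteq> k3" using k1 by auto
    then show ?thesis using dist by (simp add: color_class_insert)
  qed
  have "card (N v1 \<inter> color_class c ?S k1) \<le> card (N v1 \<inter> ?S)"
    using f by (intro card_mono) (auto simp: color_class_def)
  then have t1: "tree_coloring t (?c2(v1 := k1)) (insert v1 ?S2)"
    by (intro tree_coloring_insert[OF t2]) (use f dist k1 K(1) cl1 n1 in auto)
  have S1: "insert v1 ?S2 = S" using in_S by auto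
  have "int (card (color_class (?c2(v1 := k1)) S k)) = int m + 1" if "k < t" for k
  proof -
    have "int (card (color_class (?c2(v1 := k1)) (insert v1 ?S2) k)) =
      int (card (color_class c ?S k)) + of_bool (k = k3) + of_bool (k = k2) + of_bool (k = k1)"
      using f dist int_card_class_insert[of ?S v3 c k3 k] int_card_class_insert[of ?S3 v2 ?c3 k2 k]
        int_card_class_insert[of ?S2 v1 ?c2 k1 k] by simp
    then have "int (card (color_class (?c2(v1 := k1)) S k)) =
      int (card (color_class c ?S k)) + of_bool (k = k3) + of_bool (k = k2) + of_bool (k = k1)"
      unfolding S1 .
    also have "\<dots> = int m + 1"
    proof (cases "k \<in> K")
      case True
      then have "k = k1 \<or> k = k2 \<or> k = k3" using k1 by blast
      moreover have "k1 \<noteq> k2" "k1 \<noteq> k3" "k2 \<noteq> k3" using k1 k2 by auto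
      ultimately show ?thesis using K(3)[OF True] by auto
    next
      case False
      then have "k \<noteq> k1" "k \<noteq> k2" "k \<noteq> k3" using k1 k2 k3 by auto
      then show ?thesis using K(4)[OF that False] by simp
    qed
    finally show ?thesis .
  qed
  then show ?thesis using t1 unfolding S1 by (rule equitably_colorable_if_equal[rotated])
qed

end

text \<open>In a smallest counterexample, an equitable colouring of the graph without a vertex \<open>v\<close> of
  minimum degree has exactly one small class \<open>i0\<close>, since \<open>v\<close> has two neighbours in each small class.\<close>

locale critical = sparse_triangle_free N acyc V
  for N :: "'a \<Rightarrow> 'a set" and acyc and V +
  fixes t s :: nat and S :: "'a set" and v :: 'a and c :: "'a \<Rightarrow> nat" and i0 :: nat
  assumes t3: "3 \<le> t" and SV: "S \<subseteq> V" and card_S: "card S = t * s"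
    and vS: "v \<in> S"
    and smaller: "T \<subset> S \<Longrightarrow> equitably_colorable t T"
    and not_colorable: "\<not> equitably_colorable t S"
    and v_deg: "card (N v \<inter> S) \<le> 3"
    and v_min: "w \<in> S \<Longrightarrow> card (N v \<inter> S) \<le> card (N w \<inter> S)"
    and col: "tree_coloring t c (S - {v})"
    and i0: "i0 < t" and card_i0: "card (color_class c (S - {v}) i0) + 1 = s"
    and card_other: "i < t \<Longrightarrow> i \<noteq> i0 \<Longrightarrow> card (color_class c (S - {v}) i) = s"
begin

section \<open>The small class and the degrees into it\<close>

definition "V1 = color_class c (S - {v}) i0"
text \<open>The uncoloured vertex \<open>v\<close> belongs to \<open>H\<close>, which therefore has
  one vertex more than the \<open>t - 1\<close> full classes together.\<close>

definition "H = S - V1"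
definition "a w = card (N w \<inter> V1)"
definition "h w = card (N w \<inter> H)"
definition "d w = card (N w \<inter> S)"

abbreviation cls :: "nat \<Rightarrow> 'a set" where "cls i \<equiv> color_class c (S - {v}) i"

lemma finite_S [simp]: "finite S" using SV finite_sub by blast
lemma V1_sub: "V1 \<subseteq> S" by (auto simp: V1_def color_class_def)
lemma finite_V1 [simp]: "finite V1" using V1_sub finite_S finite_subset by blast
lemma finite_H [simp]: "finite H" by (simp add: H_def)
lemma H_sub: "H \<subseteq> S" by (auto simp: H_def)
lemma vH: "v \<in> H" using vS by (auto simp: H_def V1_def color_class_def)
lemma V1_H: "V1 \<inter> H = {}" "V1 \<union> H = S" using V1_sub by (auto simp: H_def)
lemma color_lt: "w \<in> S \<Longrightarrow> w \<noteq> v \<Longrightarrow> c w < t" using col by (auto simp: tree_coloring_def)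
lemma cls_sub_H: "i \<noteq> i0 \<Longrightarrow> cls i \<subseteq> H" by (auto simp: H_def V1_def color_class_def)
lemma H_color: "w \<in> H \<Longrightarrow> w \<noteq> v \<Longrightarrow> c w \<noteq> i0 \<and> c w < t \<and> w \<in> cls (c w)"
  using color_lt by (auto simp: H_def V1_def color_class_def)
lemma card_V1: "card V1 + 1 = s" using card_i0 by (simp add: V1_def)
lemma card_H: "int (card H) = int t * int s - int s + 1"
proof -
  have "card H = card S - card V1" unfolding H_def using V1_sub by (intro card_Diff_subset) auto
  moreover have "card V1 \<le> card S" using V1_sub by (intro card_mono) auto
  ultimately have "int (card H) = int (card S) - int (card V1)" by simp
  then show ?thesis using card_S card_V1 by auto
qed

lemma d_split: "d w = a w + h w"
proof -
  have "N w \<inter> S = (N w \<inter> V1) \<union> (N w \<inter> H)" using V1_H by auto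
  then show ?thesis unfolding a_def h_def d_def using V1_H
    by (subst card_Un_disjoint[symmetric]) auto
qed

lemma acyc_cls: "i < t \<Longrightarrow> acyc (cls i)" using col by (auto simp: tree_coloring_def)

lemma v_nbrs_V1: "2 \<le> a v"
proof (rule ccontr)
  assume "\<not> 2 \<le> a v"
  then have "card (N v \<inter> cls i0) \<le> 1" by (simp add: a_def V1_def)
  then have tc: "tree_coloring t (c(v := i0)) (insert v (S - {v}))"
    using col i0 by (intro tree_coloring_insert) auto
  have "int (card (color_class (c(v := i0)) (insert v (S - {v})) k)) = int s" if "k < t" for k
    using int_card_class_insert[of "S - {v}" v c i0 k] card_i0 card_other[OF that] by auto
  then have "equitably_colorable t (insert v (S - {v}))" using tc equitably_colorable_if_equal by blast
  then show False using not_colorable vS by (simp add: insert_absorb)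
qed

text \<open>This is what lets \<open>v\<close> fill a gap in any class contained in
  \<open>H\<close>.\<close>

lemma v_h: "h v \<le> 1" using v_nbrs_V1 v_deg d_split[of v] unfolding d_def by linarith

lemma v_h0: "3 \<le> a v \<Longrightarrow> h v = 0" using v_deg d_split[of v] unfolding d_def by linarith

lemma H_nbrs_V1:
  assumes "y \<in> H" shows "2 \<le> a y"
proof (cases "y = v")
  case False
  show ?thesis
  proof (rule ccontr)
    assume "\<not> 2 \<le> a y"
    then have 1: "card (N y \<inter> cls i0) \<le> 1" by (simp add: a_def V1_def)
    have y: "c y \<noteq> i0" "c y < t" "y \<in> S - {v}" using H_color[OF assms False] assms H_sub False by auto
    let ?c = "c(y := i0)"
    have tc: "tree_coloring t ?c (S - {v})"
      using col 1 y i0 by (intro tree_coloring_recolor) auto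
    \<comment> \<open>After \<open>y\<close> has moved to \<open>V1\<close>, its old class still
      lies in \<open>H\<close>, so \<open>v\<close> can take the free place.\<close>
    have "N v \<inter> color_class ?c (S - {v}) (c y) \<subseteq> N v \<inter> H"
      using y(1) by (auto simp: color_class_def H_def V1_def)
    then have "card (N v \<inter> color_class ?c (S - {v}) (c y)) \<le> h v"
      unfolding h_def by (intro card_mono) auto
    then have tc2: "tree_coloring t (?c(v := c y)) (insert v (S - {v}))"
      using tc y v_h by (intro tree_coloring_insert[OF tc]) auto
    have "int (card (color_class (?c(v := c y)) (insert v (S - {v})) k)) = int s" if "k < t" for k
      using int_card_class_insert[of "S - {v}" v ?c "c y" k] card_i0 card_other[OF that] y
        int_card_class_recolor[of "S - {v}" y c i0 k] by auto
    then have "equitably_colorable t (insert v (S - {v}))" using tc2 equitably_colorable_if_equal by blast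
    then show False using not_colorable vS by (simp add: insert_absorb)
  qed
qed (use v_nbrs_V1 in simp)

lemma d_ge_2: "w \<in> S \<Longrightarrow> 2 \<le> d w"
  using v_min[of w] v_nbrs_V1 d_split[of v] by (simp add: d_def)

lemma sum_a_swap: "(\<Sum>x\<in>V1. card (N x \<inter> H)) = (\<Sum>y\<in>H. a y)"
proof -
  have "(\<Sum>x\<in>V1. card (N x \<inter> H)) = (\<Sum>x\<in>V1. \<Sum>y\<in>H. of_bool (y \<in> N x))"
    by (intro sum.cong refl) (simp add: of_bool_def sum.If_cases Int_commute)
  also have "\<dots> = (\<Sum>y\<in>H. \<Sum>x\<in>V1. of_bool (y \<in> N x))" by (rule sum.swap)
  also have "\<dots> = (\<Sum>y\<in>H. a y)"
  proof (intro sum.cong refl)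
    fix y
    have "V1 \<inter> {x. y \<in> N x} = N y \<inter> V1" using N_sym by auto
    then show "(\<Sum>x\<in>V1. of_bool (y \<in> N x)) = a y" unfolding a_def by (simp add: of_bool_def sum.If_cases)
  qed
  finally show ?thesis .
qed

lemma density:
  "11 * ((\<Sum>x\<in>V1. card (N x \<inter> V1)) + 2 * (\<Sum>y\<in>H. a y) + (\<Sum>y\<in>H. h y)) \<le> 40 * (t * s)"
proof -
  have "(\<Sum>w\<in>S. card (N w \<inter> S)) = (\<Sum>w\<in>S. d w)" by (simp add: d_def)
  also have "\<dots> = (\<Sum>w\<in>V1. d w) + (\<Sum>w\<in>H. d w)"
    using sum.union_disjoint[OF finite_V1 finite_H V1_H(1), of d] unfolding V1_H(2) .
  also have "(\<Sum>w\<in>V1. d w) = (\<Sum>x\<in>V1. card (N x \<inter> V1)) + (\<Sum>x\<in>V1. card (N x \<inter> H))"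
    by (simp add: d_split sum.distrib a_def h_def)
  also have "(\<Sum>w\<in>H. d w) = (\<Sum>y\<in>H. a y) + (\<Sum>y\<in>H. h y)"
    by (simp add: d_split sum.distrib)
  finally have "(\<Sum>w\<in>S. card (N w \<inter> S)) =
      (\<Sum>x\<in>V1. card (N x \<inter> V1)) + 2 * (\<Sum>y\<in>H. a y) + (\<Sum>y\<in>H. h y)"
    by (simp add: sum_a_swap)
  then show ?thesis using sparse[OF SV] card_S by simp
qed

text \<open>Otherwise at least \<open>2 s\<close> edges run between the two classes and contribute
  \<open>4 s\<close> to the sum of \<open>h\<close>. With \<open>a \<ge> 2\<close> on
  \<open>H\<close> the degree sum is at least \<open>4 (t s - s + 1) + 4 s = 4 t s + 4\<close>,
  above \<open>40/11\<close> per vertex.\<close>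

lemma ex_movable:
  assumes "i < t" "j < t" "i \<noteq> i0" "j \<noteq> i0" "i \<noteq> j"
  obtains z where "z \<in> cls i" "card (N z \<inter> cls j) \<le> 1"
proof -
  have "\<exists>z\<in>cls i. card (N z \<inter> cls j) \<le> 1"
  proof (rule ccontr)
    assume "\<not> ?thesis"
    then have two: "2 \<le> card (N z \<inter> cls j)" if "z \<in> cls i" for z using that by force
    have "2 * s = (\<Sum>z\<in>cls i. 2)" using card_other[OF assms(1,3)] by simp
    also have "\<dots> \<le> (\<Sum>z\<in>cls i. card (N z \<inter> cls j))" using two by (intro sum_mono) auto
    finally have 1: "2 * s \<le> (\<Sum>z\<in>cls i. card (N z \<inter> cls j))" .
    have "(\<Sum>z\<in>cls i. card (N z \<inter> cls j)) = (\<Sum>z\<in>cls i. \<Sum>w\<in>cls j. of_bool (w \<in> N z))"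
      by (intro sum.cong refl) (simp add: of_bool_def sum.If_cases Int_commute)
    also have "\<dots> = (\<Sum>w\<in>cls j. \<Sum>z\<in>cls i. of_bool (w \<in> N z))" by (rule sum.swap)
    also have "\<dots> = (\<Sum>w\<in>cls j. card (N w \<inter> cls i))"
    proof (intro sum.cong refl)
      fix w
      have "cls i \<inter> {z. w \<in> N z} = N w \<inter> cls i" using N_sym by auto
      then show "(\<Sum>z\<in>cls i. of_bool (w \<in> N z)) = card (N w \<inter> cls i)"
        by (simp add: of_bool_def sum.If_cases)
    qed
    finally have 2: "2 * s \<le> (\<Sum>w\<in>cls j. card (N w \<inter> cls i))" using 1 by simp
    have "(\<Sum>z\<in>cls i. card (N z \<inter> cls j)) \<le> (\<Sum>z\<in>cls i. h z)"
      unfolding h_def using cls_sub_H[OF assms(4)] by (intro sum_mono card_mono) auto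
    moreover have "(\<Sum>w\<in>cls j. card (N w \<inter> cls i)) \<le> (\<Sum>w\<in>cls j. h w)"
      unfolding h_def using cls_sub_H[OF assms(3)] by (intro sum_mono card_mono) auto
    moreover have "(\<Sum>z\<in>cls i. h z) + (\<Sum>w\<in>cls j. h w) = (\<Sum>w\<in>cls i \<union> cls j. h w)"
      using assms(5) by (intro sum.union_disjoint[symmetric]) (auto simp: color_class_def)
    moreover have "(\<Sum>w\<in>cls i \<union> cls j. h w) \<le> (\<Sum>w\<in>H. h w)"
      using cls_sub_H assms by (intro sum_mono2) auto
    ultimately have "4 * s \<le> (\<Sum>w\<in>H. h w)" using 1 2 by linarith
    moreover have "(\<Sum>y\<in>H. 2) \<le> (\<Sum>y\<in>H. a y)" using H_nbrs_V1 by (intro sum_mono) auto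
    ultimately have "11 * (4 * card H + 4 * s) \<le> 40 * (t * s)" using density by simp
    then have "11 * (4 * int (card H) + 4 * int s) \<le> 40 * (int t * int s)"
      using of_nat_mono[of "11 * (4 * card H + 4 * s)" "40 * (t * s)", where 'a = int] by simp
    moreover define P where "P = int t * int s"
    moreover have "0 \<le> P" by (simp add: P_def)
    ultimately show False unfolding card_H P_def[symmetric] by (simp add: algebra_simps)
  qed
  then show ?thesis using that by blast
qed

text \<open>Without \<open>x\<close>, each of \<open>y\<close> and \<open>y'\<close> has one
  neighbour left in \<open>V1\<close>, and they are not adjacent since both are neighbours of
  \<open>x\<close>. So both are added as leaves.\<close>

lemma acyc_exchange_V1:
  assumes "x \<in> V1" "y \<in> N x" "y' \<in> N x" "a y = 2" "a y' = 2"
  shows "acyc (insert y (insert y' (V1 - {x})))"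
proof -
  have one: "card (N w \<inter> (V1 - {x})) = 1" if "w \<in> N x" "a w = 2" for w
  proof -
    have "x \<in> N w \<inter> V1" using that assms(1) N_sym by auto
    then have "card (N w \<inter> V1 - {x}) = 1" using that unfolding a_def by simp
    then show ?thesis by (simp add: Int_Diff)
  qed
  have ac: "acyc (V1 - {x})" using acyc_cls[OF i0] by (rule acyc_subset) (auto simp: V1_def)
  have ac': "acyc (insert y' (V1 - {x}))" by (rule acyc_insert[OF ac]) (use one assms in auto)
  have "N y \<inter> insert y' (V1 - {x}) = N y \<inter> (V1 - {x})"
    using triangle_free[OF assms(2,3)] by auto
  then show ?thesis using one assms by (intro acyc_insert[OF ac']) auto
qed

text \<open>The exchange puts \<open>y\<close> and \<open>y'\<close> in place of \<open>x\<close>, which restores the size of \<open>V1\<close>.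
  If \<open>x\<close> goes to a class that lost no vertex, some vertex of that class can be passed on to the
  class of \<open>y\<close>; the vertex \<open>v\<close> fills the remaining gap.\<close>

lemma exchange:
  assumes x: "x \<in> V1" and y: "y \<in> N x \<inter> H" "y' \<in> N x \<inter> H" "y \<noteq> y'" "a y = 2" "a y' = 2"
    and i: "i < t" "i \<noteq> i0" and ac: "acyc (insert x (cls i - {y, y'}))"
    and vy: "v \<noteq> y" "v \<in> N x \<Longrightarrow> a v = 2 \<Longrightarrow> v = y'"
  shows False
proof -
  have y0: "c y \<noteq> i0" "c y < t" "y \<in> cls (c y)" using H_color y vy by auto
  have xS: "x \<in> S" "x \<noteq> v" "c x = i0" "x \<notin> H" using x V1_H by (auto simp: V1_def color_class_def)
  have yS: "y \<in> S" "y' \<in> S" "y \<noteq> x" "y' \<noteq> x" using y H_sub xS by auto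
  have acV: "acyc (insert y (insert y' (V1 - {x})))"
    using acyc_exchange_V1 x y by auto
  show False
  \<comment> \<open>If \<open>v\<close> is one of the replacements, it leaves no gap behind: only
    the class of \<open>y\<close> is short and only class \<open>i\<close> is one too large.\<close>
  proof (cases "v = y'")
    case True
    let ?c = "c(y := i0, v := i0, x := i)"
    have acV': "acyc (insert y (insert v (V1 - {x})))" and ac': "acyc (insert x (cls i - {y, v}))"
      using acV ac True by simp_all
    have tc: "tree_coloring t ?c S"
      unfolding tree_coloring_def
    proof (intro conjI ballI allI impI)
      fix w assume "w \<in> S"
      then show "?c w < t" using i i0 color_lt by auto
    next
      fix k assume k: "k < t"
      consider "k = i0" | "k = i" | "k \<noteq> i0" "k \<noteq> i" by blast
      then show "acyc (color_class ?c S k)"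
      proof cases
        case 1
        show ?thesis using acV'
          by (rule acyc_subset) (use i 1 xS(1,2) in \<open>auto simp: color_class_def V1_def\<close>)
      next
        case 2
        show ?thesis using ac'
          by (rule acyc_subset) (use i 2 xS(1,2) in \<open>auto simp: color_class_def V1_def\<close>)
      next
        case 3
        show ?thesis using acyc_cls[OF k]
          by (rule acyc_subset) (use i 3 xS(1,2) in \<open>auto simp: color_class_def V1_def\<close>)
      qed
    qed
    have sz: "int (card (color_class ?c S k)) = int s - of_bool (k = c y) + of_bool (k = i)" if "k < t" for k
    proof -
      have S': "insert v (S - {v}) = S" using vS by auto
      have "int (card (color_class (c(v := i0)) S k)) = int (card (cls k)) + of_bool (k = i0)"
        using int_card_class_insert[of "S - {v}" v c i0 k] S' by simp
      moreover have eq: "?c = (c(v := i0))(y := i0, x := i)" using vy(1) by auto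
      ultimately have "int (card (color_class ?c S k)) = int (card (cls k)) + of_bool (k = i0)
          + of_bool (k = i0) - of_bool (k = c y) + of_bool (k = i) - of_bool (k = i0)"
        unfolding eq using int_card_class_recolor[of S y "c(v := i0)" i0 k] yS xS vy
          int_card_class_recolor[of S x "(c(v := i0))(y := i0)" i k] by simp
      then show ?thesis using card_i0 card_other[OF that] by (cases "k = i0") auto
    qed
    show False
    proof (cases "i = c y")
      case True
      then have "int (card (color_class ?c S k)) = int s" if "k < t" for k using sz[OF that] by simp
      then show False using tc equitably_colorable_if_equal not_colorable by blast
    next
      case False
      obtain z where z: "z \<in> cls i" "card (N z \<inter> cls (c y)) \<le> 1"
        using ex_movable[OF i(1) y0(2) i(2) y0(1) False] .
      have zz: "z \<in> S" "z \<noteq> x" "z \<noteq> y" "z \<noteq> v" "c z = i" using z False xS i by (auto simp: color_class_def)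
      have "color_class ?c S (c y) \<subseteq> cls (c y)" using False y0 xS by (auto simp: color_class_def)
      then have "card (N z \<inter> color_class ?c S (c y)) \<le> card (N z \<inter> cls (c y))"
        by (intro card_mono) auto
      then have tc2: "tree_coloring t (?c(z := c y)) S"
        using z zz y0 by (intro tree_coloring_recolor[OF tc]) auto
      have "int (card (color_class (?c(z := c y)) S k)) = int s" if "k < t" for k
        using int_card_class_recolor[of S z ?c "c y" k] sz[OF that] zz by auto
      then show False using tc2 equitably_colorable_if_equal not_colorable by blast
    qed
  next
    case False
    have y0': "c y' \<noteq> i0" "c y' < t" "y' \<in> cls (c y')" using H_color y False by auto
    let ?S = "S - {v}"
    let ?c = "c(y := i0, y' := i0, x := i)"
    have tc: "tree_coloring t ?c ?S"
      unfolding tree_coloring_def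
    proof (intro conjI ballI allI impI)
      fix w assume "w \<in> ?S"
      then show "?c w < t" using i i0 color_lt by auto
    next
      fix k assume k: "k < t"
      consider "k = i0" | "k = i" | "k \<noteq> i0" "k \<noteq> i" by blast
      then show "acyc (color_class ?c ?S k)"
      proof cases
        case 1
        show ?thesis using acV
          by (rule acyc_subset) (use i 1 xS(1,2) in \<open>auto simp: color_class_def V1_def\<close>)
      next
        case 2
        show ?thesis using ac
          by (rule acyc_subset) (use i 2 xS(1,2) in \<open>auto simp: color_class_def V1_def\<close>)
      next
        case 3
        show ?thesis using acyc_cls[OF k]
          by (rule acyc_subset) (use i 3 xS(1,2) in \<open>auto simp: color_class_def V1_def\<close>)
      qed
    qed
    have sz: "int (card (color_class ?c ?S k)) =
        int s - of_bool (k = c y) - of_bool (k = c y') + of_bool (k = i)" if "k < t" for k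
    proof -
      have "int (card (color_class ?c ?S k)) = int (card (cls k)) + of_bool (k = i0) - of_bool (k = c y)
          + of_bool (k = i0) - of_bool (k = c y') + of_bool (k = i) - of_bool (k = i0)"
        using int_card_class_recolor[of ?S y c i0 k] yS xS vy False y(3)
          int_card_class_recolor[of ?S y' "c(y := i0)" i0 k]
          int_card_class_recolor[of ?S x "c(y := i0, y' := i0)" i k] by simp
      then show ?thesis using card_i0 card_other[OF that] by (cases "k = i0") auto
    qed
    \<comment> \<open>If \<open>v\<close> is adjacent to \<open>x\<close>, then
      \<open>a v = 2\<close> would force \<open>v = y'\<close>. So \<open>a v \<ge> 3\<close>, all
      neighbours of \<open>v\<close> are in \<open>V1\<close>, and \<open>x\<close> is the only one
      counted here.\<close>
    have N_v: "card (N v \<inter> insert x H) \<le> 1"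
    proof (cases "x \<in> N v")
      case True
      then have "v \<in> N x" using N_sym by blast
      then have "3 \<le> a v" using vy(2) False v_nbrs_V1 by force
      then have "N v \<inter> H = {}" using v_h0 unfolding h_def by simp
      then have "N v \<inter> insert x H \<subseteq> {x}" by auto
      then have "card (N v \<inter> insert x H) \<le> card {x}" by (intro card_mono) auto
      then show ?thesis by simp
    next
      case F: False
      then have "N v \<inter> insert x H = N v \<inter> H" by auto
      then show ?thesis using v_h by (simp add: h_def)
    qed
    have S': "insert v ?S = S" using vS by auto
    \<comment> \<open>Once a single class other than \<open>V1\<close> is one short,
      \<open>v\<close> completes it.\<close>
    have fin: False
      if cc: "tree_coloring t cc ?S" "k < t" "k \<noteq> i0"
        and szz: "\<And>l. l < t \<Longrightarrow> int (card (color_class cc ?S l)) = int s - of_bool (l = k)"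
        and sub: "color_class cc ?S k \<subseteq> insert x H" for cc k
    proof -
      have "card (N v \<inter> color_class cc ?S k) \<le> card (N v \<inter> insert x H)"
        using sub by (intro card_mono) auto
      then have "tree_coloring t (cc(v := k)) (insert v ?S)"
        using N_v cc by (intro tree_coloring_insert[OF cc(1)]) auto
      moreover have "int (card (color_class (cc(v := k)) (insert v ?S) l)) = int s" if "l < t" for l
        using int_card_class_insert[of ?S v cc k l] szz[OF that] by simp
      ultimately show False using equitably_colorable_if_equal not_colorable S' by metis
    qed
    have subH: "color_class ?c ?S k \<subseteq> insert x H" if "k \<noteq> i0" for k
      using that by (auto simp: color_class_def H_def V1_def)
    show False
    proof (cases "i = c y \<or> i = c y'")
      case True
      \<comment> \<open>\<open>x\<close> compensates one loss and \<open>k\<close> is the class that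
        stays one short. If \<open>y\<close> and \<open>y'\<close> both had colour \<open>i\<close>,
        it is \<open>i\<close> itself.\<close>
      define k where "k = (if i = c y then c y' else c y)"
      have "k < t" "k \<noteq> i0" using y0 y0' by (auto simp: k_def)
      moreover have "int (card (color_class ?c ?S l)) = int s - of_bool (l = k)" if "l < t" for l
        using sz[OF that] True by (auto simp: k_def)
      ultimately show False using fin[OF tc] subH by blast
    next
      case F: False
      then have ne: "i \<noteq> c y" "i \<noteq> c y'" by auto
      \<comment> \<open>Class \<open>i\<close> is too large by one, so \<open>z\<close> repays the
        loss of \<open>y\<close>; the gap of \<open>y'\<close> is left for \<open>v\<close>. This
        also works if \<open>y\<close> and \<open>y'\<close> shared a class.\<close>
      obtain z where z: "z \<in> cls i" "card (N z \<inter> cls (c y)) \<le> 1"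
        using ex_movable[OF i(1) y0(2) i(2) y0(1) ne(1)] .
      have zz: "z \<in> ?S" "z \<noteq> x" "z \<noteq> y" "z \<noteq> y'" "c z = i"
        using z ne xS i by (auto simp: color_class_def)
      have "color_class ?c ?S (c y) \<subseteq> cls (c y)" using ne y0 xS by (auto simp: color_class_def)
      then have "card (N z \<inter> color_class ?c ?S (c y)) \<le> card (N z \<inter> cls (c y))"
        by (intro card_mono) auto
      then have tc2: "tree_coloring t (?c(z := c y)) ?S"
        using z zz y0 by (intro tree_coloring_recolor[OF tc]) auto
      have "int (card (color_class (?c(z := c y)) ?S k)) = int s - of_bool (k = c y')" if "k < t" for k
        using int_card_class_recolor[of ?S z ?c "c y" k] sz[OF that] zz by auto
      moreover have "color_class (?c(z := c y)) ?S (c y') \<subseteq> insert x H"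
      proof
        fix w assume w: "w \<in> color_class (?c(z := c y)) ?S (c y')"
        have "w \<in> H" if "w \<noteq> z" "w \<noteq> x"
          using w that y0'(1) by (auto simp: color_class_def H_def V1_def split: if_splits)
        moreover have "z \<in> H" using z(1) cls_sub_H[OF i(2)] by blast
        ultimately show "w \<in> insert x H" by blast
      qed
      ultimately show False using fin[OF tc2 y0'(2,1)] by blast
    qed
  qed
qed

section \<open>Low-degree configurations excluded by the three-vertex reduction\<close>

lemma no_three_reduction:
  assumes "v1 \<in> S" "v2 \<in> S" "v3 \<in> S" "v1 \<noteq> v2" "v1 \<noteq> v3" "v2 \<noteq> v3"
    and "card (N v1 \<inter> (S - {v1, v2, v3})) \<le> 1"
    and "card (N v2 \<inter> (S - {v1, v2, v3})) \<le> 3"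
    and "card (N v3 \<inter> (S - {v1, v2, v3})) \<le> 5"
  shows False
proof -
  have "S - {v1, v2, v3} \<subset> S" using assms(1) by auto
  then show False
    using three_vertex_reduction[OF finite_S t3 card_S assms] smaller not_colorable by simp
qed

lemma card_nbrs_Diff1:
  assumes "x \<in> N u \<inter> S" "x \<in> X"
  shows "card (N u \<inter> (S - X)) + 1 \<le> d u"
proof -
  have "card (N u \<inter> (S - X)) \<le> card (N u \<inter> S - {x})" using assms by (intro card_mono) auto
  moreover have "card (N u \<inter> S - {x}) + 1 = card (N u \<inter> S)"
    using assms(1) card.remove[of "N u \<inter> S" x] by simp
  ultimately show ?thesis by (simp add: d_def)
qed

lemma card_nbrs_Diff2:
  assumes "x \<in> N u \<inter> S" "w \<in> N u \<inter> S" "x \<noteq> w" "x \<in> X" "w \<in> X"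
  shows "card (N u \<inter> (S - X)) + 2 \<le> d u"
proof -
  have "card (N u \<inter> (S - X)) \<le> card (N u \<inter> S - {x, w})" using assms by (intro card_mono) auto
  moreover have "card (N u \<inter> S - {x, w}) = card (N u \<inter> S) - card {x, w}"
    using assms by (intro card_Diff_subset) auto
  moreover have "card {x, w} \<le> card (N u \<inter> S)" using assms by (intro card_mono) auto
  ultimately show ?thesis using assms(3) by (simp add: d_def)
qed

text \<open>If \<open>d x \<le> 6\<close>, deleting \<open>u\<close> and \<open>x\<close> leaves
  \<open>u\<close> one neighbour and \<open>x\<close> at most five. The middle vertex of the
  reduction is any vertex with at most three neighbours in the remaining graph.\<close>

lemma nbr_of_2_vertex:
  assumes "u \<in> S" "d u = 2" "x \<in> N u \<inter> S"
  shows "7 \<le> d x"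
proof (rule ccontr)
  assume dx: "\<not> 7 \<le> d x"
  have ux: "u \<noteq> x" "u \<in> N x \<inter> S" using assms N_irrefl N_sym by auto
  have "card {u, x} < card S"
  proof -
    have "s \<ge> 1" using card_V1 by simp
    then have "3 * 1 \<le> t * s" using t3 by (intro mult_mono) auto
    moreover have "card {u, x} = 2" using ux by simp
    ultimately show ?thesis using card_S by linarith
  qed
  then have "S - {u, x} \<noteq> {}" using card_mono[of "{u, x}" S] by auto
  then obtain w where w: "w \<in> S - {u, x}" "card (N w \<inter> (S - {u, x})) \<le> 3"
    using ex_degree_le_3[of "S - {u, x}"] SV by blast
  have "card (N w \<inter> (S - {u, w, x})) \<le> card (N w \<inter> (S - {u, x}))" by (intro card_mono) auto
  moreover have "card (N u \<inter> (S - {u, w, x})) + 1 \<le> d u" using assms by (intro card_nbrs_Diff1) auto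
  moreover have "card (N x \<inter> (S - {u, w, x})) + 1 \<le> d x" using ux by (intro card_nbrs_Diff1[of u]) auto
  ultimately show False
    using no_three_reduction[of u w x] assms ux w dx by auto
qed

text \<open>Otherwise \<open>u\<close>, \<open>w\<close>, \<open>x\<close> have at most
  \<open>3 - 2\<close>, \<open>4 - 1\<close> and \<open>6 - 1\<close> neighbours outside the triple,
  as \<open>u\<close> is adjacent to both others.\<close>

lemma nbr_of_3_vertex:
  assumes "u \<in> S" "d u = 3" "w \<in> N u \<inter> S" "x \<in> N u \<inter> S" "w \<noteq> x" "d w \<le> 4"
  shows "7 \<le> d x"
proof (rule ccontr)
  assume dx: "\<not> 7 \<le> d x"
  have ux: "u \<noteq> x" "u \<in> N x \<inter> S" "u \<noteq> w" "u \<in> N w \<inter> S" using assms N_irrefl N_sym by auto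
  have "card (N u \<inter> (S - {u, w, x})) + 2 \<le> d u" using assms by (intro card_nbrs_Diff2[of w _ x]) auto
  moreover have "card (N w \<inter> (S - {u, w, x})) + 1 \<le> d w" using ux by (intro card_nbrs_Diff1[of u]) auto
  moreover have "card (N x \<inter> (S - {u, w, x})) + 1 \<le> d x" using ux by (intro card_nbrs_Diff1[of u]) auto
  ultimately show False
    using no_three_reduction[of u w x] assms ux dx by auto
qed

text \<open>The centre \<open>x\<close> loses two neighbours and drops to 5, \<open>w\<close> to at
  most 3 and \<open>u\<close> to 1, so the triple would be reducible.\<close>

lemma nbr_of_7_vertex:
  assumes "x \<in> S" "d x = 7" "u \<in> N x \<inter> S" "w \<in> N x \<inter> S" "u \<noteq> w" "d u = 2"
  shows "5 \<le> d w"
proof (rule ccontr)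
  assume dw: "\<not> 5 \<le> d w"
  have ux: "u \<noteq> x" "x \<in> N u \<inter> S" "w \<noteq> x" "x \<in> N w \<inter> S" using assms N_irrefl N_sym by auto
  have "card (N x \<inter> (S - {u, w, x})) + 2 \<le> d x" using assms by (intro card_nbrs_Diff2[of u _ w]) auto
  moreover have "card (N w \<inter> (S - {u, w, x})) + 1 \<le> d w" using ux by (intro card_nbrs_Diff1[of x]) auto
  moreover have "card (N u \<inter> (S - {u, w, x})) + 1 \<le> d u" using ux by (intro card_nbrs_Diff1[of x]) auto
  ultimately show False
    using no_three_reduction[of u w x] assms ux dw by auto
qed

text \<open>Discharging weights: every edge inside \<open>V1\<close> has charge 1 and every \<open>y \<in> H\<close> has charge
  \<open>a y - 2 + h y / 2\<close>, so the total charge is the number of edges minus \<open>2 * card H\<close>.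
  The part of it that \<open>w\<close> passes to its neighbour \<open>x \<in> V1\<close> is \<open>share x w\<close>. The target
  \<open>16/11\<close> per vertex of \<open>V1\<close> is what contradicts the density bound \<open>20/11\<close> when \<open>t = 3\<close>.\<close>

definition share :: "'a \<Rightarrow> 'a \<Rightarrow> real" where
  "share x w =
    (if w \<in> V1 then
       if d x \<le> 4 \<and> 7 \<le> d w then 8/11 else if 7 \<le> d x \<and> d w \<le> 4 then 3/11 else 1/2
     else if d w \<le> 2 then 0
     else if d w = 3 then
       if a w = 2 then 1/4 else if d x \<le> 4 then 5/11 else if d x \<le> 6 then 1/3 else 3/11
     else if d w \<le> 6 then 1/2
     else if d x = 2 then 8/11 else 7/10)"

lemma share_nonneg: "0 \<le> share x w" unfolding share_def by (auto split: if_splits)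

text \<open>No vertex of \<open>H\<close> overspends. Degree 2 has charge 0; degree 3 splits
  \<open>1/2\<close> in two, or splits 1 as three thirds or as \<open>5/11 + 3/11 + 3/11\<close>;
  halves are affordable from degree 4 on, and \<open>8/11\<close> to everybody from degree 8 on. At
  degree 7 only one neighbour can demand \<open>8/11\<close>, and \<open>7/10\<close> leaves room
  for that.\<close>

lemma share_H_sum:
  assumes y: "y \<in> H"
  shows "(\<Sum>x\<in>N y \<inter> V1. share x y) \<le> real (a y) - 2 + real (h y) / 2"
proof -
  let ?A = "N y \<inter> V1"
  have A: "finite ?A" "card ?A = a y" by (simp_all add: a_def)
  have AS: "x \<in> N y \<inter> S" if "x \<in> ?A" for x using that V1_sub by auto
  have yV: "y \<notin> V1" "y \<in> S" using y V1_H by auto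
  have a2: "2 \<le> a y" using H_nbrs_V1[OF y] .
  have dd: "d y = a y + h y" using d_split .
  have bound: "(\<Sum>x\<in>?A. share x y) \<le> real (a y) * b" if "\<And>x. x \<in> ?A \<Longrightarrow> share x y \<le> b" for b
    using sum_bounded_above[of ?A "\<lambda>x. share x y" b] that A by simp
  have bound1: "(\<Sum>x\<in>?A. share x y) \<le> share u y + real (a y - 1) * b"
    if u: "u \<in> ?A" and ub: "\<And>x. x \<in> ?A \<Longrightarrow> x \<noteq> u \<Longrightarrow> share x y \<le> b" for b u
  proof -
    have "(\<Sum>x\<in>?A. share x y) = share u y + (\<Sum>x\<in>?A - {u}. share x y)"
      using sum.remove[OF A(1) u] .
    moreover have "(\<Sum>x\<in>?A - {u}. share x y) \<le> real (card (?A - {u})) * b"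
      using ub by (intro sum_bounded_above) auto
    moreover have "card (?A - {u}) = a y - 1" using u A by simp
    ultimately show ?thesis by simp
  qed
  consider "d y = 2" | "d y = 3" "a y = 2" | "d y = 3" "a y = 3" | "4 \<le> d y" "d y \<le> 6"
    | "d y = 7" | "8 \<le> d y"
    using a2 dd by linarith
  then show ?thesis
  proof cases
    case 1
    then show ?thesis using bound[of 0] yV a2 dd by (simp add: share_def)
  next
    case 2
    then show ?thesis using bound[of "1/4"] yV dd by (simp add: share_def)
  next
    case 3
    show ?thesis
    \<comment> \<open>By reducibility at most one neighbour has degree at most 4; the other two then
      have degree at least 7 and need only \<open>3/11\<close>.\<close>
    proof (cases "\<exists>u\<in>?A. d u \<le> 4")
      case True
      then obtain u where u: "u \<in> ?A" "d u \<le> 4" by blast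
      have "7 \<le> d x" if "x \<in> ?A" "x \<noteq> u" for x
        using nbr_of_3_vertex[of y u x] yV 3 AS u that by auto
      then have "(\<Sum>x\<in>?A. share x y) \<le> share u y + real (a y - 1) * (3/11)"
        using 3 yV u by (intro bound1) (force simp: share_def)+
      then show ?thesis using 3 yV u dd by (simp add: share_def)
    next
      case False
      then have "share x y \<le> 1/3" if "x \<in> ?A" for x using 3 yV that by (simp add: share_def)
      then show ?thesis using bound[of "1/3"] 3 dd by simp
    qed
  next
    case 4
    then have "(\<Sum>x\<in>?A. share x y) \<le> real (a y) * (1/2)"
      using yV by (intro bound) (simp add: share_def)
    moreover have "4 \<le> real (a y) + real (h y)" using 4 dd by linarith
    ultimately show ?thesis by simp
  next
    case 5
    then have ah: "real (a y) + real (h y) = 7" "real (a y) \<le> 7" using dd by linarith+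
    show ?thesis
    \<comment> \<open>A neighbour of degree 2 forces all others to degree at least 5. The worst case
      is \<open>a y = 7\<close>, where \<open>8/11 + 6 * 7/10 < 5\<close>.\<close>
    proof (cases "\<exists>u\<in>?A. d u = 2")
      case True
      then obtain u where u: "u \<in> ?A" "d u = 2" by blast
      have "5 \<le> d x" if "x \<in> ?A" "x \<noteq> u" for x
        using nbr_of_7_vertex[of y u x] yV 5 AS u that by auto
      then have le: "(\<Sum>x\<in>?A. share x y) \<le> share u y + real (a y - 1) * (7/10)"
        using 5 yV u by (intro bound1) (force simp: share_def)+
      have "share u y = 8/11" using u yV 5 by (simp add: share_def)
      moreover have "real (a y - 1) = real (a y) - 1" using a2 by simp
      ultimately have "(\<Sum>x\<in>?A. share x y) \<le> 8/11 + (real (a y) - 1) * (7/10)"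
        using le by metis
      then show ?thesis using ah by (simp add: field_simps)
    next
      case False
      then have "share x y \<le> 7/10" if "x \<in> ?A" for x using 5 yV that by (simp add: share_def)
      then show ?thesis using bound[of "7/10"] ah by simp
    qed
  next
    case 6
    then have "(\<Sum>x\<in>?A. share x y) \<le> real (a y) * (8/11)"
      using yV by (intro bound) (simp add: share_def)
    moreover have "8 \<le> real (a y) + real (h y)" using 6 dd by linarith
    moreover have "0 \<le> real (h y)" by simp
    ultimately show ?thesis by simp
  qed
qed

text \<open>The two ends of an edge inside \<open>V1\<close> receive 1 in total, as
  \<open>8/11 + 3/11\<close> or \<open>1/2 + 1/2\<close>.\<close>

lemma share_V1_sum:
  "(\<Sum>x\<in>V1. \<Sum>w\<in>N x \<inter> V1. share x w) = (\<Sum>x\<in>V1. real (card (N x \<inter> V1))) / 2"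
proof -
  have eq: "N x \<inter> V1 = {w. w \<in> V1 \<and> w \<in> N x}" "{w. w \<in> V1 \<and> x \<in> N w} = N x \<inter> V1" for x
    using N_sym by auto
  have "(\<Sum>x\<in>V1. \<Sum>w\<in>N x \<inter> V1. share x w) = (\<Sum>w\<in>V1. \<Sum>x\<in>N w \<inter> V1. share x w)"
    using sum.swap_restrict[OF finite_V1 finite_V1, of share "\<lambda>x w. w \<in> N x"]
    unfolding eq(1)[symmetric] eq(2) .
  then have "2 * (\<Sum>x\<in>V1. \<Sum>w\<in>N x \<inter> V1. share x w) =
      (\<Sum>x\<in>V1. \<Sum>w\<in>N x \<inter> V1. share x w + share w x)"
    by (simp add: sum.distrib)
  also have "\<dots> = (\<Sum>x\<in>V1. \<Sum>w\<in>N x \<inter> V1. 1)"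
    by (intro sum.cong refl) (auto simp: share_def)
  finally show ?thesis by simp
qed

lemma share_total:
  "(\<Sum>x\<in>V1. \<Sum>w\<in>N x \<inter> S. share x w) \<le>
     (\<Sum>x\<in>V1. real (card (N x \<inter> V1))) / 2 + (\<Sum>y\<in>H. real (a y) - 2 + real (h y) / 2)"
proof -
  have split: "(\<Sum>w\<in>N x \<inter> S. share x w) = (\<Sum>w\<in>N x \<inter> V1. share x w) + (\<Sum>w\<in>N x \<inter> H. share x w)" for x
  proof -
    have e: "N x \<inter> S = (N x \<inter> V1) \<union> (N x \<inter> H)" using V1_H by auto
    show ?thesis unfolding e using V1_H by (intro sum.union_disjoint) auto
  qed
  have eq: "N x \<inter> H = {w. w \<in> H \<and> w \<in> N x}" "{w. w \<in> V1 \<and> x \<in> N w} = N x \<inter> V1" for x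
    using N_sym by auto
  have "(\<Sum>x\<in>V1. \<Sum>w\<in>N x \<inter> H. share x w) = (\<Sum>w\<in>H. \<Sum>x\<in>N w \<inter> V1. share x w)"
    using sum.swap_restrict[OF finite_V1 finite_H, of share "\<lambda>x w. w \<in> N x"]
    unfolding eq(1)[symmetric] eq(2) .
  also have "\<dots> \<le> (\<Sum>y\<in>H. real (a y) - 2 + real (h y) / 2)"
    by (intro sum_mono share_H_sum)
  finally show ?thesis using share_V1_sum by (simp add: split sum.distrib)
qed

section \<open>Lower bounds for the charge received in \<open>V1\<close>\<close>

text \<open>Vertices of this kind become leaves when \<open>x\<close> leaves \<open>V1\<close>, so
  any two of them can replace \<open>x\<close>.\<close>

definition "private x = {y \<in> N x \<inter> H. a y = 2}"

text \<open>If class \<open>i\<close> gave less than \<open>8/11\<close>, too few neighbours of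
  \<open>x\<close> in it could have neighbours in \<open>H\<close>. Then \<open>x\<close> would fit
  into the class after a suitable \<open>y\<close> is taken out, and \<open>exchange\<close> would
  apply.\<close>

lemma share_rich_class:
  assumes x: "x \<in> V1" and rich: "2 \<le> card (private x)" and i: "i < t" "i \<noteq> i0"
  shows "8/11 \<le> (\<Sum>w\<in>N x \<inter> cls i. share x w)"
proof (rule ccontr)
  assume small: "\<not> ?thesis"
  \<comment> \<open>A neighbour of \<open>x\<close> outside \<open>R\<close> is isolated in its
    class and cannot close a cycle. Members of \<open>R\<close> give at least \<open>1/4\<close> if
    private and \<open>1/2\<close> otherwise.\<close>
  define R where "R = {w \<in> N x \<inter> cls i. h w \<noteq> 0}"
  define P where "P = R \<inter> private x"
  define Q where "Q = R - private x"
  have fin: "finite R" "finite P" "finite Q" "finite (private x)"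
    by (simp_all add: R_def P_def Q_def private_def)
  have RH: "w \<in> H" "w \<in> S" "w \<notin> V1" "d w = a w + h w" "2 \<le> a w" "1 \<le> h w" if "w \<in> R" for w
    using that cls_sub_H[OF i(2)] V1_H d_split H_nbrs_V1 by (auto simp: R_def)
  have P4: "1/4 \<le> share x w" if "w \<in> P" for w
    using that RH[of w] by (auto simp: share_def P_def)
  have Q2: "1/2 \<le> share x w" if "w \<in> Q" for w
  proof -
    have "a w \<noteq> 2" using that RH[of w] by (auto simp: Q_def private_def R_def)
    then show ?thesis using that RH[of w] by (auto simp: share_def Q_def)
  qed
  have "real (card P) * (1/4) \<le> (\<Sum>w\<in>P. share x w)" using P4 by (intro sum_bounded_below) auto
  moreover have "real (card Q) * (1/2) \<le> (\<Sum>w\<in>Q. share x w)" using Q2 by (intro sum_bounded_below) auto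
  moreover have "(\<Sum>w\<in>P. share x w) + (\<Sum>w\<in>Q. share x w) = (\<Sum>w\<in>P \<union> Q. share x w)"
    using fin by (intro sum.union_disjoint[symmetric]) (auto simp: P_def Q_def)
  moreover have "(\<Sum>w\<in>P \<union> Q. share x w) \<le> (\<Sum>w\<in>N x \<inter> cls i. share x w)"
    by (intro sum_mono2) (auto simp: P_def Q_def R_def share_nonneg)
  ultimately have lt: "real (card P) * (1/4) + real (card Q) * (1/2) < 8/11" using small by linarith
  then have "real (card P) + 2 * real (card Q) < 3" by linarith
  then have le2: "card P + 2 * card Q \<le> 2" by linarith
  have cR: "card R = card P + card Q"
    unfolding P_def Q_def using fin(1) by (rule card_Int_Diff)
  have vR: "v \<notin> R" by (auto simp: R_def color_class_def)
  \<comment> \<open>Since \<open>card P + 2 * card Q \<le> 2\<close>, either \<open>P\<close> is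
    empty and \<open>R\<close> has at most one element, or removing some \<open>y\<close> from
    \<open>P\<close> leaves at most one.\<close>
  have "\<exists>y\<in>private x. y \<noteq> v \<and> card (R - {y}) \<le> 1"
  proof (cases "P = {}")
    case False
    then obtain y where y: "y \<in> P" by blast
    then have "card P \<noteq> 0" using fin by auto
    then have "card R \<le> 2" using cR le2 by linarith
    moreover have "y \<in> R" using y by (auto simp: P_def)
    ultimately show ?thesis using y vR fin by (intro bexI[of _ y]) (auto simp: P_def)
  next
    case True
    have "private x - {v} \<noteq> {}" using rich card_mono[of "{v}" "private x"] by auto
    then obtain y where y: "y \<in> private x - {v}" by blast
    have "card (R - {y}) \<le> card R" using fin by (intro card_mono) auto
    then show ?thesis using y cR le2 True by (intro bexI[of _ y]) auto
  qed
  then obtain y where y: "y \<in> private x" "y \<noteq> v" "card (R - {y}) \<le> 1" by blast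
  \<comment> \<open>If \<open>v\<close> is private, it must be the second replacement, as
    \<open>exchange\<close> requires.\<close>
  obtain y' where y': "y' \<in> private x" "y' \<noteq> y" "v \<in> private x \<Longrightarrow> y' = v"
  proof (cases "v \<in> private x")
    case True
    then show ?thesis using that y by blast
  next
    case False
    have "private x - {y} \<noteq> {}" using rich card_mono[of "{y}" "private x"] by auto
    then obtain y' where "y' \<in> private x - {y}" by blast
    then show ?thesis using that False by blast
  qed
  have "acyc (insert x (cls i - {y, y'}))"
  proof (rule acyc_insert_isolated)
    show "acyc (cls i - {y, y'})" using acyc_cls[OF i(1)] by (rule acyc_subset) auto
    have "{w \<in> N x \<inter> (cls i - {y, y'}). N w \<inter> (cls i - {y, y'}) \<noteq> {}} \<subseteq> R - {y}"
    proof
      fix w assume w: "w \<in> {w \<in> N x \<inter> (cls i - {y, y'}). N w \<inter> (cls i - {y, y'}) \<noteq> {}}"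
      then have "N w \<inter> H \<noteq> {}" using cls_sub_H[OF i(2)] by auto
      then have "h w \<noteq> 0" by (simp add: h_def)
      then show "w \<in> R - {y}" using w by (auto simp: R_def)
    qed
    then have "card {w \<in> N x \<inter> (cls i - {y, y'}). N w \<inter> (cls i - {y, y'}) \<noteq> {}} \<le> card (R - {y})"
      using fin by (intro card_mono) auto
    then show "card {w \<in> N x \<inter> (cls i - {y, y'}). N w \<inter> (cls i - {y, y'}) \<noteq> {}} \<le> 1"
      using y by linarith
  qed simp
  moreover have "v = y'" if "v \<in> N x" "a v = 2" using y'(3) that vH by (auto simp: private_def)
  ultimately show False
    using exchange[of x y y' i] x y y' i by (auto simp: private_def)
qed

text \<open>With two private neighbours, two classes other than \<open>V1\<close> give
  \<open>8/11\<close> each. Otherwise at most one neighbour gives little, and the degree decides: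
  \<open>2 * 8/11\<close> for 2; \<open>1/4 + 2 * 7/10\<close> or \<open>3 * 1/2\<close> for 3;
  \<open>3 * 5/11 + 1/4\<close> for 4; at least \<open>4/3 + 1/4\<close> for 5 and 6; at least
  \<open>6 * 3/11\<close> from 7 on. Only degree 2 and the first case are tight.\<close>

lemma share_ge:
  assumes x: "x \<in> V1"
  shows "16/11 \<le> (\<Sum>w\<in>N x \<inter> S. share x w)"
proof (cases "2 \<le> card (private x)")
  case True
  have "card ({..<t} - {i0}) = t - 1" using i0 by simp
  then have "2 \<le> card ({..<t} - {i0})" using t3 by linarith
  then obtain i j where ij: "i \<in> {..<t} - {i0}" "j \<in> {..<t} - {i0}" "i \<noteq> j"
    by (auto simp: card_le_Suc_iff numeral_2_eq_2)
  have "(\<Sum>w\<in>N x \<inter> cls i. share x w) + (\<Sum>w\<in>N x \<inter> cls j. share x w) =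
      (\<Sum>w\<in>(N x \<inter> cls i) \<union> (N x \<inter> cls j). share x w)"
    using ij by (intro sum.union_disjoint[symmetric]) (auto simp: color_class_def)
  also have "\<dots> \<le> (\<Sum>w\<in>N x \<inter> S. share x w)"
    by (intro sum_mono2) (auto simp: color_class_def share_nonneg)
  finally show ?thesis using share_rich_class[OF x True, of i] share_rich_class[OF x True, of j] ij by auto
next
  case False
  then have poor: "card (private x) \<le> 1" by simp
  let ?A = "N x \<inter> S"
  have xS: "x \<in> S" using x V1_sub by blast
  have A: "finite ?A" "card ?A = d x" by (simp_all add: d_def)
  have d2: "2 \<le> d x" using d_ge_2[OF xS] .
  then have Ane: "?A \<noteq> {}" using A by auto
  have PA: "private x \<subseteq> ?A" using H_sub by (auto simp: private_def)
  have nbr: "x \<in> N w \<inter> S" "w \<in> S" "2 \<le> d w" if "w \<in> ?A" for w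
    using that N_sym xS d_ge_2 by auto
  have no2: "d w \<noteq> 2" if "w \<in> ?A" "d x < 7" for w
    using nbr_of_2_vertex[of w x] nbr[OF that(1)] that by auto
  have a3: "3 \<le> a w" "3 \<le> d w" if "w \<in> ?A - private x" "w \<notin> V1" for w
  proof -
    have "w \<in> H" using that V1_H by auto
    then show "3 \<le> a w" using H_nbrs_V1[of w] that by (force simp: private_def)
    then show "3 \<le> d w" using d_split[of w] by simp
  qed
  have bound: "(real (d x) - 1) * m + p \<le> (\<Sum>w\<in>?A. share x w)"
    if "p \<le> m" "\<And>w. w \<in> ?A - private x \<Longrightarrow> m \<le> share x w" "\<And>w. w \<in> private x \<Longrightarrow> p \<le> share x w"
    for m p
    using sum_ge_one_exception[OF A(1) PA poor Ane that] A(2) by simp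
  consider "d x = 2" | "d x = 3" | "d x = 4" | "5 \<le> d x" "d x \<le> 6" | "7 \<le> d x" using d2 by linarith
  then show ?thesis
  proof cases
    case 1
    have "8/11 \<le> share x w" if "w \<in> ?A" for w
      using nbr_of_2_vertex[OF xS 1 that] 1 by (auto simp: share_def)
    then have "real (card ?A) * (8/11) \<le> (\<Sum>w\<in>?A. share x w)" by (intro sum_bounded_below) auto
    then show ?thesis using A 1 by simp
  next
    case 2
    show ?thesis
    proof (cases "\<exists>u\<in>?A. d u \<le> 4")
      case True
      then obtain u where u: "u \<in> ?A" "d u \<le> 4" by blast
      have big: "7/10 \<le> share x w" if "w \<in> ?A - {u}" for w
        using nbr_of_3_vertex[of x u w] xS 2 u that by (auto simp: share_def)
      have "1/4 \<le> share x u" using no2[of u] u 2 nbr(3)[of u] by (auto simp: share_def)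
      moreover have "real (card (?A - {u})) * (7/10) \<le> (\<Sum>w\<in>?A - {u}. share x w)"
        using big by (intro sum_bounded_below) auto
      moreover have "card (?A - {u}) = 2" using u A 2 by simp
      moreover have "(\<Sum>w\<in>?A. share x w) = share x u + (\<Sum>w\<in>?A - {u}. share x w)"
        using sum.remove[OF A(1) u(1)] .
      ultimately show ?thesis by simp
    next
      case F: False
      have "1/2 \<le> share x w" if "w \<in> ?A" for w
      proof -
        have "\<not> d w \<le> 4" using F that by blast
        then show ?thesis using 2 by (auto simp: share_def)
      qed
      then have "real (card ?A) * (1/2) \<le> (\<Sum>w\<in>?A. share x w)" by (intro sum_bounded_below) auto
      then show ?thesis using A 2 by simp
    qed
  next
    case 3
    have "5/11 \<le> share x w" if "w \<in> ?A - private x" for w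
      using a3[OF that] 3 by (cases "w \<in> V1") (auto simp: share_def)
    moreover have "1/4 \<le> share x w" if "w \<in> private x" for w
    proof -
      have "w \<in> ?A" using PA that by blast
      then show ?thesis using no2[of w] nbr(3)[of w] 3 by (auto simp: share_def)
    qed
    ultimately show ?thesis using bound[of "1/4" "5/11"] 3 by simp
  next
    case 4
    have "1/3 \<le> share x w" if "w \<in> ?A - private x" for w
      using a3[OF that] 4 by (cases "w \<in> V1") (auto simp: share_def)
    moreover have "1/4 \<le> share x w" if "w \<in> private x" for w
    proof -
      have "w \<in> ?A" using PA that by blast
      then show ?thesis using no2[of w] nbr(3)[of w] 4 by (auto simp: share_def)
    qed
    ultimately have "(real (d x) - 1) * (1/3) + 1/4 \<le> (\<Sum>w\<in>?A. share x w)" by (intro bound) auto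
    moreover have "4 * (1/3) \<le> (real (d x) - 1) * (1/3)" using 4 by (intro mult_right_mono) auto
    ultimately show ?thesis by linarith
  next
    case 5
    have "3/11 \<le> share x w" if "w \<in> ?A - private x" for w
      using a3[OF that] 5 by (cases "w \<in> V1") (auto simp: share_def)
    then have "(real (d x) - 1) * (3/11) + 0 \<le> (\<Sum>w\<in>?A. share x w)"
      by (intro bound) (auto simp: share_nonneg)
    moreover have "6 * (3/11) \<le> (real (d x) - 1) * (3/11)" using 5 by (intro mult_right_mono) auto
    ultimately show ?thesis by linarith
  qed
qed

text \<open>This contradicts \<open>t3\<close>: no critical configuration exists.\<close>

lemma t_less_3: "t < 3"
proof (rule ccontr)
  assume "\<not> t < 3"
  define b where "b = (\<Sum>x\<in>V1. real (card (N x \<inter> V1)))"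
  define ta where "ta = (\<Sum>y\<in>H. real (a y))"
  define th where "th = (\<Sum>y\<in>H. real (h y))"
  define P where "P = real t * real s"
  have "real (card V1) * (16/11) \<le> (\<Sum>x\<in>V1. \<Sum>w\<in>N x \<inter> S. share x w)"
    using share_ge by (intro sum_bounded_below) auto
  also have "\<dots> \<le> b / 2 + (\<Sum>y\<in>H. real (a y) - 2 + real (h y) / 2)"
    unfolding b_def by (rule share_total)
  also have "(\<Sum>y\<in>H. real (a y) - 2 + real (h y) / 2) = ta - 2 * real (card H) + th / 2"
    by (simp add: sum.distrib sum_subtractf ta_def th_def sum_divide_distrib)
  finally have 1: "real (card V1) * (16/11) \<le> b / 2 + (ta - 2 * real (card H) + th / 2)" .
  have 2: "11 * (b + 2 * ta + th) \<le> 40 * P"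
    using of_nat_mono[OF density, where 'a = real] by (simp add: b_def ta_def th_def P_def)
  have 3: "real (card V1) = real s - 1" using card_V1 by linarith
  have "real_of_int (int (card H)) = real_of_int (int t * int s - int s + 1)" using card_H by simp
  then have 4: "real (card H) = P - real s + 1" by (simp add: P_def)
  have 5: "3 * real s \<le> P" unfolding P_def using t3 by (intro mult_right_mono) auto
  \<comment> \<open>Twice inequality \<open>1\<close>, scaled by 11, eliminates all edge counts
    against \<open>2\<close>.\<close>
  have 7: "32 * real (card V1) \<le> 40 * P - 44 * real (card H)" using 1 2 by (simp add: algebra_simps)
  \<comment> \<open>Substituting the class sizes gives \<open>P \<le> 3 s - 3\<close>, whereas
    \<open>t \<ge> 3\<close> gives \<open>P \<ge> 3 s\<close>.\<close>
  show False using 7 5 unfolding 3 4 by (simp add: algebra_simps)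
qed

end

section \<open>Extraction of a smallest counterexample\<close>

context sparse_triangle_free
begin

text \<open>Induction over vertex subsets with \<open>t\<close> fixed supplies a colouring of
  \<open>S - {v}\<close>. Failure to extend it forces two neighbours of \<open>v\<close> in each
  smallest class, so there is just one such class; this is also why \<open>card S\<close> is a
  multiple of \<open>t\<close>.\<close>

theorem equitably_colorable_sparse:
  assumes t: "3 \<le> t" and "S \<subseteq> V"
  shows "equitably_colorable t S"
  using assms(2)
proof (induction "card S" arbitrary: S rule: less_induct)
  case less
  note SV = less.prems
  have finS: "finite S" using SV finite_sub by blast
  have IH: "equitably_colorable t T" if "T \<subset> S" for T
    using less.hyps[of T] psubset_card_mono[OF finS that] that SV by auto
  show ?case
  proof (cases "S = {}")
    case True
    then show ?thesis
      by (auto simp: equitably_colorable_def tree_coloring_def equitable_def color_class_def acyc_empty)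
  next
    case False
    show ?thesis
    proof (rule ccontr)
      assume nc: "\<not> equitably_colorable t S"
      obtain v where v: "v \<in> S" "\<And>w. w \<in> S \<Longrightarrow> card (N v \<inter> S) \<le> card (N w \<inter> S)"
        using finS False ex_min_if_finite[of "(\<lambda>w. card (N w \<inter> S)) ` S"]
        by (auto simp: not_less)
      obtain w where "w \<in> S" "card (N w \<inter> S) \<le> 3" using ex_degree_le_3[OF SV False] by blast
      then have v3: "card (N v \<inter> S) \<le> 3" using v(2)[of w] by linarith
      let ?S = "S - {v}"
      have "?S \<subset> S" using v by blast
      then obtain c where c: "tree_coloring t c ?S" "equitable t c ?S"
        using IH by (auto simp: equitably_colorable_def)
      have f: "finite ?S" using finS by simp
      obtain m K where K: "K \<subseteq> {..<t}" "K \<noteq> {}" "\<And>i. i \<in> K \<Longrightarrow> card (color_class c ?S i) = m"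
        "\<And>i. i < t \<Longrightarrow> i \<notin> K \<Longrightarrow> card (color_class c ?S i) = m + 1"
        "card ?S + card K = t * (m + 1)"
      proof (rule equitable_class_sizes[of ?S t c])
        show "finite ?S" "0 < t" using f t by auto
      qed (use c in auto)
      have fK: "finite K" using K(1) finite_subset by blast
      have nv: "card (N v \<inter> ?S) \<le> 3"
      proof -
        have "card (N v \<inter> ?S) \<le> card (N v \<inter> S)" using finS by (intro card_mono) auto
        then show ?thesis using v3 by simp
      qed
      have S': "insert v ?S = S" using v by blast
      have "2 \<le> card (N v \<inter> color_class c ?S i)" if "i \<in> K" for i
      proof (rule ccontr)
        assume "\<not> 2 \<le> card (N v \<inter> color_class c ?S i)"
        then have tc: "tree_coloring t (c(v := i)) (insert v ?S)"
          using c f that K(1) by (intro tree_coloring_insert) auto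
        have sz: "int (card (color_class (c(v := i)) (insert v ?S) k)) =
            int (card (color_class c ?S k)) + of_bool (k = i)" for k
          using f by (intro int_card_class_insert) auto
        have "m \<le> card (color_class (c(v := i)) (insert v ?S) k)
            \<and> card (color_class (c(v := i)) (insert v ?S) k) \<le> m + 1" if "k < t" for k
          using sz[of k] K(3)[of k] K(4)[OF that] \<open>i \<in> K\<close> by (cases "k \<in> K"; cases "k = i") auto
        then have "equitable t (c(v := i)) (insert v ?S)"
          unfolding equitable_def by (meson add_le_mono1 le_trans)
        then show False using tc nc S' by (auto simp: equitably_colorable_def)
      qed
      then have "\<forall>i\<in>K. 2 \<le> card (N v \<inter> color_class c ?S i)" by blast
      then have "2 * card K \<le> 3" using card_nbrs_disjoint_classes[OF f K(1), of v c] nv by linarith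
      moreover have "card K \<noteq> 0" using K(2) fK by simp
      ultimately have "card K = 1" by linarith
      then obtain i0 where i0: "K = {i0}" by (auto simp: card_1_singleton_iff)
      have "Suc (card ?S) = card S" by (rule card_Suc_Diff1[OF finS v(1)])
      then have cS: "card S = t * (m + 1)" using K(5) \<open>card K = 1\<close> by linarith
      have "critical N acyc V t (m + 1) S v c i0"
      proof (rule critical.intro[OF sparse_triangle_free_axioms], rule critical_axioms.intro)
        show "i0 < t" "card (color_class c ?S i0) + 1 = m + 1" using K(1,3) i0 by auto
        show "card (color_class c ?S i) = m + 1" if "i < t" "i \<noteq> i0" for i
          using K(4)[OF that(1)] that(2) i0 by blast
      qed (fact t SV cS v IH nc v3 c(1))+
      then have "t < 3" by (rule critical.t_less_3)
      then show False using t by simp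
    qed
  qed
qed

end

section \<open>Planar graphs without triangles and adjacent 4-cycles\<close>

definition nbrs :: "'a set set \<Rightarrow> 'a \<Rightarrow> 'a set" where
  "nbrs E v = {w. {v, w} \<in> E}"

lemma nbrs_sym: "w \<in> nbrs E v \<Longrightarrow> v \<in> nbrs E w"
  by (simp add: nbrs_def insert_commute)

lemma nbrs_irrefl: "simple_graph V E \<Longrightarrow> v \<notin> nbrs E v"
  by (auto simp: nbrs_def simple_graph_def)

lemma nbrs_triangle_free:
  assumes "simple_graph V E" "4 \<le> girth E" "u \<in> nbrs E v" "w \<in> nbrs E v"
  shows "w \<notin> nbrs E u"
proof
  assume w: "w \<in> nbrs E u"
  let ?C = "cycle_edges [v, u, w]"
  have C: "?C = (\<lambda>i. {[v, u, w] ! i, [v, u, w] ! (Suc i mod 3)}) ` {..<3}"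
    by (auto simp: cycle_edges_def)
  have "distinct [v, u, w]" using assms(3,4) w nbrs_irrefl[OF assms(1)] by auto
  moreover have "?C \<subseteq> E"
  proof
    fix e assume "e \<in> ?C"
    then obtain i where i: "i < 3" "e = {[v, u, w] ! i, [v, u, w] ! (Suc i mod 3)}" unfolding C by blast
    then consider "i = 0" | "i = 1" | "i = 2" by linarith
    then show "e \<in> E" using i(2) assms(3,4) w by cases (auto simp: nbrs_def insert_commute)
  qed
  ultimately have "?C \<in> cycles E" unfolding cycles_def by (intro CollectI exI[of _ "[v, u, w]"]) auto
  then have "girth E \<le> enat (card ?C)" unfolding girth_def by (rule INF_lower)
  moreover have "card ?C \<le> 3" unfolding C using card_image_le[OF finite_lessThan, of _ 3] by simp
  ultimately have "girth E \<le> enat 3" by (meson enat_ord_simps(1) order_trans)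
  then have "(4::enat) \<le> enat 3" using assms(2) by (rule order_trans[rotated])
  then show False by (simp add: numeral_eq_enat)
qed

lemma induced_edges_mono: "A \<subseteq> B \<Longrightarrow> induced_edges E A \<subseteq> induced_edges E B"
  by (auto simp: induced_edges_def)

lemma forest_induced_empty:
  assumes "simple_graph V E"
  shows "forest (induced_edges E {})"
proof -
  have "{} \<notin> E" using assms by (auto simp: simple_graph_def)
  then have "induced_edges E {} = {}" by (auto simp: induced_edges_def)
  moreover have "cycle_edges vs \<noteq> {}" if "3 \<le> length vs" for vs :: "'a list"
  proof -
    have "{vs ! 0, vs ! (Suc 0 mod length vs)} \<in> cycle_edges vs"
      unfolding cycle_edges_def using that by (intro CollectI exI[of _ 0]) auto
    then show ?thesis by blast
  qed
  ultimately show ?thesis by (auto simp: forest_def cycles_def)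
qed

text \<open>On a cycle through \<open>v\<close>, its predecessor and successor would be two distinct
  neighbours of \<open>v\<close> in \<open>A\<close>.\<close>

lemma forest_induced_insert:
  assumes simple: "simple_graph V E" and forest: "forest (induced_edges E A)"
    and fin: "finite A" and one: "card (nbrs E v \<inter> A) \<le> 1"
  shows "forest (induced_edges E (insert v A))"
proof (rule ccontr)
  assume "\<not> ?thesis"
  then obtain vs where vs: "3 \<le> length vs" "distinct vs" "cycle_edges vs \<subseteq> induced_edges E (insert v A)"
    by (auto simp: forest_def cycles_def)
  let ?n = "length vs"
  have edge: "{vs ! i, vs ! (Suc i mod ?n)} \<in> E" "{vs ! i, vs ! (Suc i mod ?n)} \<subseteq> insert v A" if "i < ?n" for i
  proof -
    have "{vs ! i, vs ! (Suc i mod ?n)} \<in> cycle_edges vs" using that by (auto simp: cycle_edges_def)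
    then show "{vs ! i, vs ! (Suc i mod ?n)} \<in> E" "{vs ! i, vs ! (Suc i mod ?n)} \<subseteq> insert v A"
      using vs(3) by (auto simp: induced_edges_def)
  qed
  show False
  proof (cases "v \<in> set vs")
    case False
    have "cycle_edges vs \<subseteq> induced_edges E A"
    proof
      fix e assume "e \<in> cycle_edges vs"
      then obtain i where i: "i < ?n" "e = {vs ! i, vs ! (Suc i mod ?n)}" by (auto simp: cycle_edges_def)
      have "Suc i mod ?n < ?n" using i by (intro mod_less_divisor) auto
      then have "vs ! i \<noteq> v" "vs ! (Suc i mod ?n) \<noteq> v" using False i(1) nth_mem by metis+
      then show "e \<in> induced_edges E A" using edge[OF i(1)] i(2) by (auto simp: induced_edges_def)
    qed
    then show False using vs forest by (auto simp: forest_def cycles_def)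
  next
    case True
    then obtain i where i: "i < ?n" "vs ! i = v" by (auto simp: in_set_conv_nth)
    \<comment> \<open>\<open>j\<close> and \<open>k\<close> are the cyclic predecessor and successor
      positions; they differ because the cycle has at least three vertices.\<close>
    define j where "j = (if i = 0 then ?n - 1 else i - 1)"
    define k where "k = Suc i mod ?n"
    have j: "j < ?n" "Suc j mod ?n = i" using i vs(1) by (auto simp: j_def)
    have k: "k < ?n" unfolding k_def using i by (intro mod_less_divisor) auto
    have kk: "k = (if Suc i = ?n then 0 else Suc i)" using i by (auto simp: k_def)
    have ne: "j \<noteq> i" "k \<noteq> i" "j \<noteq> k" using i vs(1) unfolding kk j_def by auto
    then have dist: "vs ! j \<noteq> v" "vs ! k \<noteq> v" "vs ! j \<noteq> vs ! k"
      using vs(2) i j k by (auto simp: nth_eq_iff_index_eq)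
    have "{vs ! j, vs ! k} \<subseteq> nbrs E v \<inter> A"
      using edge[OF i(1)] edge[OF j(1)] i(2) j(2) dist
      by (auto simp: nbrs_def k_def[symmetric] insert_commute)
    then have "card {vs ! j, vs ! k} \<le> card (nbrs E v \<inter> A)" using fin by (intro card_mono) auto
    then show False using one dist by simp
  qed
qed

text \<open>The handshake lemma, by double counting incident pairs.\<close>

lemma sum_degrees_induced:
  assumes simple: "simple_graph V E" and "S \<subseteq> V"
  shows "(\<Sum>v\<in>S. card (nbrs E v \<inter> S)) = 2 * card (induced_edges E S)"
proof -
  let ?F = "induced_edges E S"
  have finS: "finite S" using assms by (auto simp: simple_graph_def intro: finite_subset)
  have "?F \<subseteq> Pow S" by (auto simp: induced_edges_def)
  then have finF: "finite ?F" using finS by (meson finite_Pow_iff finite_subset)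
  have two: "card e = 2" if "e \<in> ?F" for e using that simple by (auto simp: induced_edges_def simple_graph_def)
  have "card (nbrs E v \<inter> S) = card {e. e \<in> ?F \<and> v \<in> e}" if v: "v \<in> S" for v
  proof (rule bij_betw_same_card[of "\<lambda>w. {v, w}"])
    show "bij_betw (\<lambda>w. {v, w}) (nbrs E v \<inter> S) {e. e \<in> ?F \<and> v \<in> e}"
      unfolding bij_betw_def
    proof
      show "inj_on (\<lambda>w. {v, w}) (nbrs E v \<inter> S)" by (auto simp: inj_on_def doubleton_eq_iff)
      show "(\<lambda>w. {v, w}) ` (nbrs E v \<inter> S) = {e. e \<in> ?F \<and> v \<in> e}"
      proof (intro equalityI subsetI)
        fix e assume "e \<in> (\<lambda>w. {v, w}) ` (nbrs E v \<inter> S)"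
        then show "e \<in> {e. e \<in> ?F \<and> v \<in> e}" using v by (auto simp: nbrs_def induced_edges_def)
      next
        fix e assume e: "e \<in> {e. e \<in> ?F \<and> v \<in> e}"
        then have "card e = 2" using two by blast
        then obtain w where w: "e = {v, w}" using e by (auto simp: card_2_iff)
        then show "e \<in> (\<lambda>w. {v, w}) ` (nbrs E v \<inter> S)" using e by (auto simp: nbrs_def induced_edges_def)
      qed
    qed
  qed
  then have "(\<Sum>v\<in>S. card (nbrs E v \<inter> S)) = (\<Sum>v\<in>S. \<Sum>e\<in>{e. e \<in> ?F \<and> v \<in> e}. 1)" by simp
  also have "\<dots> = (\<Sum>e\<in>?F. \<Sum>v\<in>{v. v \<in> S \<and> v \<in> e}. 1)" by (rule sum.swap_restrict[OF finS finF])
  also have "\<dots> = (\<Sum>e\<in>?F. 2)"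
  proof (rule sum.cong[OF refl])
    fix e assume e: "e \<in> ?F"
    then have "{v. v \<in> S \<and> v \<in> e} = e" by (auto simp: induced_edges_def)
    then show "(\<Sum>v\<in>{v. v \<in> S \<and> v \<in> e}. 1) = (2::nat)" using two[OF e] by simp
  qed
  finally show ?thesis by simp
qed

text \<open>The drawing restricts to \<open>S\<close>, and induced subgraphs inherit both cycle
  conditions. So the edge bound for plane graphs holds for every \<open>S\<close>.\<close>

lemma planar_sparse:
  assumes simple: "simple_graph V E" and "planar V E" and girth: "4 \<le> girth E"
    and nonadj: "\<forall>C\<in>cycles_of_length 4 E. \<forall>C'\<in>cycles_of_length 4 E. \<not> adjacent_cycles C C'"
    and S: "S \<subseteq> V"
  shows "11 * (\<Sum>v\<in>S. card (nbrs E v \<inter> S)) \<le> 40 * card S"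
proof -
  let ?F = "induced_edges E S"
  have FE: "?F \<subseteq> E" by (auto simp: induced_edges_def)
  obtain p \<gamma> where d: "plane_drawing V E p \<gamma>" using assms(2) by (auto simp: planar_def)
  have "simple_graph S ?F"
    using simple S by (auto simp: simple_graph_def induced_edges_def intro: finite_subset)
  moreover have "plane_drawing S ?F p \<gamma>"
    unfolding plane_drawing_def
  proof (intro conjI ballI impI)
    show "inj_on p S" using d S by (auto simp: plane_drawing_def intro: inj_on_subset)
  next
    fix e assume e: "e \<in> ?F"
    then have "e \<in> E" "e \<subseteq> S" by (auto simp: induced_edges_def)
    then have "arc (\<gamma> e)" "{pathstart (\<gamma> e), pathfinish (\<gamma> e)} = p ` e" "path_image (\<gamma> e) \<inter> p ` V = p ` e"
      using d by (auto simp: plane_drawing_def)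
    then show "arc (\<gamma> e)" "{pathstart (\<gamma> e), pathfinish (\<gamma> e)} = p ` e" "path_image (\<gamma> e) \<inter> p ` S = p ` e"
      using \<open>e \<subseteq> S\<close> S by blast+
  next
    fix e e' assume "e \<in> ?F" "e' \<in> ?F" "e \<noteq> e'"
    then show "path_image (\<gamma> e) \<inter> path_image (\<gamma> e') \<subseteq> p ` (e \<inter> e')"
      using d FE unfolding plane_drawing_def by blast
  qed
  ultimately interpret plane_graph S ?F p \<gamma> by unfold_locales
  have "girth E \<le> girth ?F" unfolding girth_def by (rule INF_superset_mono) (use cycles_mono[OF FE] in auto)
  then have "4 \<le> girth ?F" using girth by (rule order_trans[rotated])
  moreover have "cycles_of_length 4 ?F \<subseteq> cycles_of_length 4 E"
    using cycles_mono[OF FE] by (auto simp: cycles_of_length_def)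
  ultimately have "11 * card ?F \<le> 20 * card S" using nonadj card_edges_le by (meson subsetD)
  then show ?thesis using sum_degrees_induced[OF assms(1) S] by simp
qed

theorem theorem2:
  fixes V :: "'a set" and E :: "'a set set"
  assumes "simple_graph V E"
    and "planar V E"
    and "girth E \<ge> 4"
    and "\<forall>C\<in>cycles_of_length 4 E. \<forall>D\<in>cycles_of_length 4 E. \<not> adjacent_cycles C D"
  shows "strong_equitable_vertex_arboricity V E \<le> 3 \<and>
         (\<forall>t\<ge>3. has_equitable_tree_coloring V E t)"
proof -
  have fin: "finite V" using assms(1) by (simp add: simple_graph_def)
  interpret sparse_triangle_free "nbrs E" "\<lambda>S. forest (induced_edges E S)" V
  proof unfold_locales
    show "forest (induced_edges E A)" if "forest (induced_edges E B)" "A \<subseteq> B" for A B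
      using that cycles_mono[OF induced_edges_mono[OF that(2), of E]] by (auto simp: forest_def)
    show "11 * (\<Sum>v\<in>S. card (nbrs E v \<inter> S)) \<le> 40 * card S" if "S \<subseteq> V" for S
      using planar_sparse[OF assms that] .
  qed (fact nbrs_sym nbrs_irrefl[OF assms(1)] nbrs_triangle_free[OF assms(1,3)]
      forest_induced_empty[OF assms(1)] forest_induced_insert[OF assms(1)] fin)+
  have col: "has_equitable_tree_coloring V E t" if t: "3 \<le> t" for t
  proof -
    obtain c where c: "tree_coloring t c V" "equitable t c V"
      using equitably_colorable_sparse[OF t order_refl] by (auto simp: equitably_colorable_def)
    obtain m K where K: "K \<subseteq> {..<t}" "K \<noteq> {}" "\<And>i. i \<in> K \<Longrightarrow> card (color_class c V i) = m"
      "\<And>i. i < t \<Longrightarrow> i \<notin> K \<Longrightarrow> card (color_class c V i) = m + 1"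
      "card V + card K = t * (m + 1)"
    proof (rule equitable_class_sizes[of V t c])
      show "0 < t" using t by simp
    qed (use fin c in auto)
    have finK: "finite K" using K(1) finite_subset by blast
    have K0: "0 < card K" using K(2) finK by (simp add: card_gt_0_iff)
    have Kt: "card K \<le> t" using card_mono[OF _ K(1)] by simp
    have eq: "real (card V) + real (card K) = real t * (real m + 1)"
      using arg_cong[OF K(5), of real] by (simp add: algebra_simps)
    \<comment> \<open>From \<open>card V = t (m + 1) - card K\<close> with
      \<open>1 \<le> card K \<le> t\<close> the quotient lies in \<open>[m, m + 1)\<close>. A class
      of size \<open>m + 1\<close> exists only if \<open>card K < t\<close>, and then the ceiling is
      \<open>m + 1\<close>.\<close>
    have size: "int (card (color_class c V i)) = \<lceil>real (card V) / real t\<rceil> \<or>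
        int (card (color_class c V i)) = \<lfloor>real (card V) / real t\<rfloor>" if i: "i < t" for i
    proof (cases "i \<in> K")
      case True
      have "\<lfloor>real (card V) / real t\<rfloor> = int m"
        using eq K0 Kt t by (intro floor_unique) (auto simp: field_simps)
      then show ?thesis using K(3)[OF True] by simp
    next
      case False
      then have "K \<subset> {..<t}" using K(1) i by blast
      then have "card K < t" using psubset_card_mono[of "{..<t}" K] by simp
      then have "\<lceil>real (card V) / real t\<rceil> = int m + 1"
        using eq t by (intro ceiling_unique) (auto simp: field_simps)
      then show ?thesis using K(4)[OF i False] by simp
    qed
    have "equitable_tree_coloring V E t (color_class c V)"
      unfolding equitable_tree_coloring_def
    proof (intro conjI allI impI)
      show "disjoint_family_on (color_class c V) {..<t}"
        by (auto simp: disjoint_family_on_def color_class_def)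
      show "(\<Union>i<t. color_class c V i) = V" using c(1) by (auto simp: tree_coloring_def color_class_def)
    qed (use size c(1) in \<open>auto simp: tree_coloring_def\<close>)
    then show ?thesis by (auto simp: has_equitable_tree_coloring_def)
  qed
  moreover have "strong_equitable_vertex_arboricity V E \<le> 3"
    unfolding strong_equitable_vertex_arboricity_def using col by (intro Least_le) blast
  ultimately show ?thesis by blast
qed

end
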